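(* There is a constant $C>0$, depending only on the scattering kernel, such that for every $k>0$, with $\varphi(p)=e^{kp^0}$, and all non-negative measurable functions $f,h$ on $[0,1]\times\mathbb{R}^3$, $$\int_{\mathbb{R}^3}\varphi(p)\,\|Q^+(f,h)(\cdot,p)\|_{L^\infty_{x_1}([0,1])}\,dp\le C\,k^{-1}\,\|f\|_{-1}\,\|h\| .$$
   Context: Notation. For $p\in\mathbb{R}^3$: $p^0=\sqrt{1+|p|^2}$. For $p,q\in\mathbb{R}^3$: $g=g(p,q)=\sqrt{|p-q|^2-(p^0-q^0)^2}$, $s=g^2+4$, $v_{\o}=\dfrac{g\sqrt s}{p^0q^0}$. Collisions. For $\omega\in\mathbb{S}^2$ and $\gamma=(p^0+q^0)/\sqrt s$, $$p'=\tfrac{p+q}2+\tfrac g2\Big(\omega+(\gamma-1)(p+q)\tfrac{(p+q)\cdot\omega}{|p+q|^2}\Big),\qquad q'=\tfrac{p+q}2-\tfrac g2\Big(\omega+(\gamma-1)(p+q)\tfrac{(p+q)\cdot\omega}{|p+q|^2}\Big),$$ and the scattering angle $\theta$ is given by $\cos\theta=g^{-2}\big[-(p^0-q^0)(p'^0-q'^0)+(p-q)\cdot(p'-q')\big]$. Scattering kernel (hard spheres). $\sigma(g,\theta)\ge0$ is measurable with $\sigma(g,\theta)\approx g\,\sigma_0(\theta)$ (two-sided bounds with fixed positive constants), where $0\le\sigma_0(\theta)\le\frac1{4\pi}$ is measurable and $\int_{\mathbb{S}^2}\sigma_0(\theta)\,d\omega=c_0\le1$. Gain operator: $Q^+(f,h)(x_1,p)=\int_{\mathbb{R}^3}\int_{\mathbb{S}^2}v_{\o}\,\sigma(g,\theta)f(x_1,p')h(x_1,q')\,d\omega\,dq$.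 Norms: $\|u(\cdot,p)\|_{L^\infty_{x_1}}=\operatorname{ess\,sup}_{x_1\in[0,1]}|u(x_1,p)|$, $$\|f\|=\int_{\mathbb{R}^3}(p^0)^{1/2}\varphi(p)\|f(\cdot,p)\|_{L^\infty_{x_1}}dp,\qquad \|f\|_{-1}=\sup_{a\in\mathbb{R}^3}\int_{\mathbb{R}^3}\frac{(p^0)^{1/2}\varphi(p)}{|p-a|}\|f(\cdot,p)\|_{L^\infty_{x_1}}dp .$$ *)

theory Defs
  imports "HOL-Analysis.Analysis" "HOL-Probability.Essential_Supremum"
begin

text \<open>
  Surface measure on the unit sphere, as the cone measure: the area of \<open>A\<close> is three times the
  volume of the solid cone \<open>{x. 0 < \<bar>x\<bar> < 1 \<and> x / \<bar>x\<bar> \<in> A}\<close>.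
\<close>

definition sphere_measure :: "(real^3) measure" where
  "sphere_measure =
     scale_measure 3
       (distr (restrict_space lborel (ball 0 1 - {0})) (restrict_space borel (sphere 0 1))
          (\<lambda>x. x /\<^sub>R norm x))"

lemma space_sphere_measure [simp]: "space sphere_measure = sphere 0 1"
  by (simp add: sphere_measure_def space_scale_measure space_restrict_space)

lemma normalize_measurable_sphere:
  "(\<lambda>x::real^3. x /\<^sub>R norm x) \<in>
     restrict_space lborel (ball 0 1 - {0}) \<rightarrow>\<^sub>M restrict_space borel (sphere 0 1)"
  by (rule measurable_restrict_space3) (auto intro: borel_measurable_scaleR)

lemma emeasure_sphere_measure_total:
  "emeasure sphere_measure (sphere 0 1) = ennreal (4 * pi)"
proof -
  let ?B = "ball 0 1 - {0} :: (real^3) set"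
  have "emeasure sphere_measure (sphere 0 1) = 3 * emeasure lborel ?B"
  proof -
    have "(\<lambda>x. x /\<^sub>R norm x) -` sphere 0 1 \<inter> ?B = ?B" by auto
    moreover have "sphere (0::real^3) 1 \<in> sets (restrict_space borel (sphere 0 1))"
      by (simp add: sets_restrict_space_iff)
    ultimately show ?thesis
      by (simp add: sphere_measure_def emeasure_distr[OF normalize_measurable_sphere]
          space_restrict_space emeasure_restrict_space)
  qed
  also have "emeasure lborel ?B = emeasure lborel (ball (0::real^3) 1)"
    by (subst emeasure_Diff) auto
  also have "\<dots> = ennreal (4 / 3 * pi)"
    by (simp add: emeasure_ball unit_ball_vol_3)
  finally show ?thesis
    by (metis (no_types, lifting) ennreal_mult'' ennreal_numeral mult.assoc nonzero_mult_div_cancel_left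
        pi_ge_zero times_divide_eq_left times_divide_eq_right zero_le_divide_iff zero_le_mult_iff
        zero_le_numeral zero_neq_numeral mult.commute)
qed

definition energy :: "real^3 \<Rightarrow> real" where
  "energy p = sqrt (1 + (norm p)\<^sup>2)"

definition rel_momentum :: "real^3 \<Rightarrow> real^3 \<Rightarrow> real" where
  "rel_momentum p q = sqrt ((norm (p - q))\<^sup>2 - (energy p - energy q)\<^sup>2)"

definition mandelstam_s :: "real^3 \<Rightarrow> real^3 \<Rightarrow> real" where
  "mandelstam_s p q = (rel_momentum p q)\<^sup>2 + 4"

definition moller_velocity :: "real^3 \<Rightarrow> real^3 \<Rightarrow> real" where
  "moller_velocity p q =
     rel_momentum p q * sqrt (mandelstam_s p q) / (energy p * energy q)"

definition lorentz_gamma :: "real^3 \<Rightarrow> real^3 \<Rightarrow> real" where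
  "lorentz_gamma p q = (energy p + energy q) / sqrt (mandelstam_s p q)"

text \<open>
  Since \<open>x / 0 = 0\<close>, this equals \<open>\<omega>\<close> for \<open>p + q = 0\<close>, the correct limit value.
\<close>

definition boosted_direction :: "real^3 \<Rightarrow> real^3 \<Rightarrow> real^3 \<Rightarrow> real^3" where
  "boosted_direction p q \<omega> =
     \<omega> + ((lorentz_gamma p q - 1) * (((p + q) \<bullet> \<omega>) / (norm (p + q))\<^sup>2)) *\<^sub>R (p + q)"

definition post_p :: "real^3 \<Rightarrow> real^3 \<Rightarrow> real^3 \<Rightarrow> real^3" where
  "post_p p q \<omega> =
     (1/2) *\<^sub>R (p + q) + (rel_momentum p q / 2) *\<^sub>R boosted_direction p q \<omega>"

definition post_q :: "real^3 \<Rightarrow> real^3 \<Rightarrow> real^3 \<Rightarrow> real^3" where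
  "post_q p q \<omega> =
     (1/2) *\<^sub>R (p + q) - (rel_momentum p q / 2) *\<^sub>R boosted_direction p q \<omega>"

definition cos_scattering :: "real^3 \<Rightarrow> real^3 \<Rightarrow> real^3 \<Rightarrow> real" where
  "cos_scattering p q \<omega> =
     (- (energy p - energy q) * (energy (post_p p q \<omega>) - energy (post_q p q \<omega>))
      + (p - q) \<bullet> (post_p p q \<omega> - post_q p q \<omega>)) / (rel_momentum p q)\<^sup>2"

definition scattering_angle :: "real^3 \<Rightarrow> real^3 \<Rightarrow> real^3 \<Rightarrow> real" where
  "scattering_angle p q \<omega> = arccos (cos_scattering p q \<omega>)"

text \<open>
  \<open>\<sigma>\<close> is only constrained on its domain \<open>g \<ge> 0\<close>, \<open>\<theta> \<in> [0, \<pi>]\<close>. The angle \<open>\<theta>\<close> depends on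
  \<open>(p, q, \<omega>)\<close> and is defined when \<open>p \<noteq> q\<close> (equivalently \<open>g > 0\<close>); it is the angle between \<open>\<omega>\<close> and
  a unit vector determined by \<open>(p, q)\<close>, so the integral of \<open>\<sigma>\<^sub>0 (\<theta>)\<close> over the sphere is the same
  for all such pairs. \<open>nn_integral\<close> is insensitive to completing the measure.
\<close>

definition hard_sphere_kernel :: "(real \<Rightarrow> real \<Rightarrow> real) \<Rightarrow> (real \<Rightarrow> real) \<Rightarrow> bool" where
  "hard_sphere_kernel \<sigma> \<sigma>\<^sub>0 \<longleftrightarrow>
     (\<lambda>(g, \<theta>). \<sigma> g \<theta>) \<in> borel_measurable (lebesgue_on ({0..} \<times> {0..pi})) \<and>
     (\<forall>g\<ge>0. \<forall>\<theta>\<in>{0..pi}. 0 \<le> \<sigma> g \<theta>) \<and>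
     \<sigma>\<^sub>0 \<in> borel_measurable (lebesgue_on {0..pi}) \<and>
     (\<forall>\<theta>\<in>{0..pi}. 0 \<le> \<sigma>\<^sub>0 \<theta> \<and> \<sigma>\<^sub>0 \<theta> \<le> 1 / (4 * pi)) \<and>
     (\<exists>c\<^sub>1>0. \<exists>c\<^sub>2>0. \<forall>g\<ge>0. \<forall>\<theta>\<in>{0..pi}.
        c\<^sub>1 * (g * \<sigma>\<^sub>0 \<theta>) \<le> \<sigma> g \<theta> \<and> \<sigma> g \<theta> \<le> c\<^sub>2 * (g * \<sigma>\<^sub>0 \<theta>)) \<and>
     (\<exists>c\<^sub>0. 0 \<le> c\<^sub>0 \<and> c\<^sub>0 \<le> 1 \<and>
        (\<forall>p q. p \<noteq> q \<longrightarrow>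
           (\<integral>\<^sup>+ \<omega>. ennreal (\<sigma>\<^sub>0 (scattering_angle p q \<omega>)) \<partial>sphere_measure) = ennreal c\<^sub>0))"

definition gain ::
  "(real \<Rightarrow> real \<Rightarrow> real) \<Rightarrow> (real \<Rightarrow> real^3 \<Rightarrow> real) \<Rightarrow> (real \<Rightarrow> real^3 \<Rightarrow> real)
     \<Rightarrow> real \<Rightarrow> real^3 \<Rightarrow> ennreal" where
  "gain \<sigma> f h x p =
     (\<integral>\<^sup>+ q. (\<integral>\<^sup>+ \<omega>. ennreal (moller_velocity p q
                * \<sigma> (rel_momentum p q) (scattering_angle p q \<omega>)
                * f x (post_p p q \<omega>) * h x (post_q p q \<omega>)) \<partial>sphere_measure) \<partial>lebesgue)"

definition Linf :: "(real \<Rightarrow> ennreal) \<Rightarrow> ennreal" where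
  "Linf u = esssup (lebesgue_on {0..1}) u"

text \<open>In the weighted norms, \<open>\<phi>\<close> is the weight.\<close>

definition weighted_norm :: "(real^3 \<Rightarrow> real) \<Rightarrow> (real \<Rightarrow> real^3 \<Rightarrow> real) \<Rightarrow> ennreal" where
  "weighted_norm \<phi> f =
     (\<integral>\<^sup>+ p. ennreal (sqrt (energy p) * \<phi> p) * Linf (\<lambda>x. ennreal \<bar>f x p\<bar>) \<partial>lebesgue)"

definition weighted_norm_m1 :: "(real^3 \<Rightarrow> real) \<Rightarrow> (real \<Rightarrow> real^3 \<Rightarrow> real) \<Rightarrow> ennreal" where
  "weighted_norm_m1 \<phi> f =
     (SUP a. \<integral>\<^sup>+ p. ennreal (sqrt (energy p) * \<phi> p / norm (p - a))
                    * Linf (\<lambda>x. ennreal \<bar>f x p\<bar>) \<partial>lebesgue)"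

definition exp_weight :: "real \<Rightarrow> real^3 \<Rightarrow> real" where
  "exp_weight k p = exp (k * energy p)"

end

theory Submission
  imports Defs "HOL-Probability.Distributions"
begin

text \<open>
  The kernel satisfies \<open>\<sigma> \<le> c g / (4\<pi>)\<close>. Write a pair \<open>(p, q)\<close> in centre-of-mass coordinates
  \<open>(P, u)\<close>, where \<open>P = p + q\<close> and \<open>u\<close> is the relative momentum boosted to the centre-of-mass frame, so
  that \<open>\<bar>u\<bar> = g\<close>; a collision with parameter \<open>\<omega>\<close> replaces \<open>u\<close> by \<open>\<bar>u\<bar> \<omega>\<close>. The Jacobian of
  \<open>u \<mapsto> p\<close> for fixed \<open>P\<close> is \<open>p\<^sup>0 q\<^sup>0 / (2 E \<surd>s)\<close> with \<open>E = p\<^sup>0 + q\<^sup>0\<close>, and \<open>E\<close> and \<open>s\<close> depend only on \<open>P\<close>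
  and \<open>\<bar>u\<bar>\<close>. Hence exchanging the two directions \<open>u / \<bar>u\<bar>\<close> and \<open>\<omega>\<close> shows that
  \<open>dp dq d\<omega> / (p\<^sup>0 q\<^sup>0)\<close> is invariant under \<open>(p, q) \<leftrightarrow> (p', q')\<close>. After this exchange only
  \<open>\<phi>(p')\<close> depends on \<open>\<omega>\<close>. Since \<open>p'\<^sup>0 = E/2 + g \<omega>\<bullet>P / (2 \<surd>s)\<close>, its integral over the sphere
  is at most a multiple of \<open>\<phi>(p) \<phi>(q) \<surd>s / (k g \<bar>P\<bar>)\<close>: the factor \<open>1 / \<bar>P\<bar>\<close> is absorbed by the
  norm of \<open>f\<close> with \<open>a = -q\<close>, and \<open>g s \<le> 8 (p\<^sup>0 q\<^sup>0)\<^bsup>3/2\<^esup>\<close> yields the weights \<open>(p\<^sup>0)\<^bsup>1/2\<^esup>\<close>, \<open>(q\<^sup>0)\<^bsup>1/2\<^esup>\<close>.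
  The same change of variables shows that the collision map pulls null sets back to null sets, so \<open>f\<close>, \<open>h\<close>
  and \<open>\<sigma>\<close> may be replaced by Borel functions.
\<close>

section \<open>Centre-of-mass coordinates\<close>

text \<open>With \<open>norm u\<close> in the role of g this is the square root of s.\<close>

definition cm_sqrt_s :: "real^3 \<Rightarrow> real" where
  "cm_sqrt_s u = sqrt (4 + (norm u)\<^sup>2)"

text \<open>The total energy of the pair, by the mass-shell relation E^2 = s + |P|^2.\<close>

definition cm_energy :: "real^3 \<Rightarrow> real^3 \<Rightarrow> real" where
  "cm_energy P u = sqrt (4 + (norm u)\<^sup>2 + (norm P)\<^sup>2)"

text \<open>
  With \<open>\<gamma> = E / \<surd>s\<close>, this is \<open>(\<gamma> - 1) / \<bar>P\<bar>\<^sup>2\<close> written so that it stays smooth at \<open>P = 0\<close>.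
\<close>

definition cm_coeff :: "real^3 \<Rightarrow> real^3 \<Rightarrow> real" where
  "cm_coeff P u = 1 / (cm_sqrt_s u * (cm_energy P u + cm_sqrt_s u))"

text \<open>The spatial part of the relative four-momentum p - q: the four-vector (0, u) of the
  centre-of-mass frame, boosted to the frame in which the total momentum is P.\<close>

definition cm_boost :: "real^3 \<Rightarrow> real^3 \<Rightarrow> real^3" where
  "cm_boost P u = u + ((P \<bullet> u) * cm_coeff P u) *\<^sub>R P"

definition cm_p :: "real^3 \<Rightarrow> real^3 \<Rightarrow> real^3" where
  "cm_p P u = (1/2) *\<^sub>R (P + cm_boost P u)"

definition cm_q :: "real^3 \<Rightarrow> real^3 \<Rightarrow> real^3" where
  "cm_q P u = (1/2) *\<^sub>R (P - cm_boost P u)"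

lemma cm_sqrt_s_pos: "cm_sqrt_s u > 0"
  and cm_energy_pos: "cm_energy P u > 0"
  and cm_sqrt_s_sq: "(cm_sqrt_s u)\<^sup>2 = 4 + (norm u)\<^sup>2"
  and cm_energy_sq: "(cm_energy P u)\<^sup>2 = (cm_sqrt_s u)\<^sup>2 + P \<bullet> P"
  by (auto simp: cm_sqrt_s_def cm_energy_def add_pos_nonneg dot_square_norm)

text \<open>The factorisation |P|^2 = (E + sqrt s) (E - sqrt s) cancels the denominator, with no
  case distinction at P = 0.\<close>

lemma cm_coeff_mult_norm:
  "cm_coeff P u * (P \<bullet> P) = cm_energy P u / cm_sqrt_s u - 1"
proof -
  have "P \<bullet> P = (cm_energy P u + cm_sqrt_s u) * (cm_energy P u - cm_sqrt_s u)"
    using cm_energy_sq[of P u] by (simp add: algebra_simps power2_eq_square)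
  then have "cm_coeff P u * (P \<bullet> P) = (cm_energy P u - cm_sqrt_s u) / cm_sqrt_s u"
    using cm_sqrt_s_pos[of u] cm_energy_pos[of P u] by (simp add: cm_coeff_def)
  then show ?thesis
    using cm_sqrt_s_pos[of u] by (simp add: diff_divide_distrib)
qed

text \<open>A collision changes only the direction of u, hence preserves these quantities.\<close>

lemma cm_norm_cong:
  assumes "norm u = norm v"
  shows "cm_sqrt_s u = cm_sqrt_s v" "cm_energy P u = cm_energy P v" "cm_coeff P u = cm_coeff P v"
  using assms by (simp_all add: cm_coeff_def cm_sqrt_s_def cm_energy_def)

lemma inner_cm_boost: "P \<bullet> cm_boost P u = cm_energy P u / cm_sqrt_s u * (P \<bullet> u)"
proof -
  have "P \<bullet> cm_boost P u = (P \<bullet> u) * (1 + cm_coeff P u * (P \<bullet> P))"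
    by (simp add: cm_boost_def algebra_simps)
  then show ?thesis by (simp add: cm_coeff_mult_norm)
qed

text \<open>Lorentz invariance: the boosts of (0, u) and (0, v) have time components P.u / sqrt s
  and P.v / sqrt s, and their Minkowski product is still u.v.\<close>

lemma cm_boost_inner_cm_boost:
  assumes "norm u = norm v"
  shows "cm_boost P u \<bullet> cm_boost P v = u \<bullet> v + (P \<bullet> u) * (P \<bullet> v) / (cm_sqrt_s u)\<^sup>2"
proof -
  let ?m = "cm_coeff P u"
  have "cm_boost P u \<bullet> cm_boost P v = u \<bullet> v + (P \<bullet> u) * (P \<bullet> v) * (2 * ?m + ?m * (?m * (P \<bullet> P)))"
    by (simp add: cm_boost_def cm_norm_cong(3)[OF assms, of P] algebra_simps inner_commute)
  also have "2 * ?m + ?m * (?m * (P \<bullet> P)) = ?m * (cm_energy P u + cm_sqrt_s u) / cm_sqrt_s u"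
    unfolding cm_coeff_mult_norm using cm_sqrt_s_pos[of u] by (simp add: field_simps)
  also have "\<dots> = 1 / (cm_sqrt_s u)\<^sup>2"
  proof -
    have "cm_energy P u + cm_sqrt_s u \<noteq> 0"
      using cm_sqrt_s_pos[of u] cm_energy_pos[of P u] by simp
    then show ?thesis by (simp add: cm_coeff_def power2_eq_square)
  qed
  finally show ?thesis by simp
qed

text \<open>This makes the formula in \<open>energy_cm_p\<close> non-negative, which selects the
  right square root.\<close>

lemma abs_inner_less_cm: "\<bar>P \<bullet> u\<bar> < cm_energy P u * cm_sqrt_s u"
proof -
  have "\<bar>P \<bullet> u\<bar> \<le> norm P * norm u" by (rule Cauchy_Schwarz_ineq2)
  also have "\<dots> \<le> cm_energy P u * norm u"
    by (intro mult_right_mono) (auto simp: cm_energy_def intro!: real_le_rsqrt)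
  also have "\<dots> < cm_energy P u * cm_sqrt_s u"
    using cm_energy_pos[of P u] by (intro mult_strict_left_mono) (auto simp: cm_sqrt_s_def intro!: real_less_rsqrt)
  finally show ?thesis .
qed

lemma cm_boost_minus: "cm_boost P (- u) = - cm_boost P u"
  by (simp add: cm_boost_def cm_norm_cong[of "-u" u])

lemma cm_q_eq_cm_p: "cm_q P u = cm_p P (- u)"
  by (simp add: cm_q_def cm_p_def cm_boost_minus)

lemma cm_p_add_cm_q: "cm_p P u + cm_q P u = P"
  and cm_p_diff_cm_q: "cm_p P u - cm_q P u = cm_boost P u"
  by (simp_all add: cm_p_def cm_q_def scaleR_right_diff_distrib scaleR_right_distrib flip: scaleR_left_distrib)

lemma energy_cm_p: "energy (cm_p P u) = cm_energy P u / 2 + P \<bullet> u / (2 * cm_sqrt_s u)"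
  unfolding energy_def
proof (rule real_sqrt_unique)
  have "(norm (cm_p P u))\<^sup>2 = (P \<bullet> P + 2 * (P \<bullet> cm_boost P u) + cm_boost P u \<bullet> cm_boost P u) / 4"
    by (simp add: cm_p_def power2_norm_eq_inner inner_add_left inner_add_right inner_commute field_simps)
  then have "4 * (1 + (norm (cm_p P u))\<^sup>2) = (4 + u \<bullet> u + P \<bullet> P) + 2 * (cm_energy P u / cm_sqrt_s u * (P \<bullet> u))
     + (P \<bullet> u)\<^sup>2 / (cm_sqrt_s u)\<^sup>2"
    by (simp add: inner_cm_boost cm_boost_inner_cm_boost power2_eq_square)
  also have "4 + u \<bullet> u + P \<bullet> P = (cm_energy P u)\<^sup>2"
    by (simp add: cm_energy_sq cm_sqrt_s_sq dot_square_norm)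
  finally show "(cm_energy P u / 2 + P \<bullet> u / (2 * cm_sqrt_s u))\<^sup>2 = 1 + (norm (cm_p P u))\<^sup>2"
    using cm_sqrt_s_pos[of u] by (simp add: field_simps power2_eq_square)
  have "- (P \<bullet> u) \<le> cm_energy P u * cm_sqrt_s u"
    using abs_inner_less_cm[of P u] by linarith
  then have "- (P \<bullet> u) / cm_sqrt_s u \<le> cm_energy P u"
    using cm_sqrt_s_pos[of u] by (simp only: pos_divide_le_eq)
  then show "0 \<le> cm_energy P u / 2 + P \<bullet> u / (2 * cm_sqrt_s u)"
    by simp
qed

lemma energy_cm_q: "energy (cm_q P u) = cm_energy P u / 2 - P \<bullet> u / (2 * cm_sqrt_s u)"
  by (simp add: cm_q_eq_cm_p energy_cm_p cm_norm_cong[of "-u" u])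

lemma energy_cm_sum: "energy (cm_p P u) + energy (cm_q P u) = cm_energy P u"
  and energy_cm_diff: "energy (cm_p P u) - energy (cm_q P u) = P \<bullet> u / cm_sqrt_s u"
  by (simp_all add: energy_cm_p energy_cm_q)

lemma rel_momentum_cm: "rel_momentum (cm_p P u) (cm_q P u) = norm u"
  unfolding rel_momentum_def cm_p_diff_cm_q energy_cm_diff
  by (simp add: power2_norm_eq_inner cm_boost_inner_cm_boost[OF refl] power_divide)
     (simp add: power2_eq_square norm_eq_sqrt_inner)

lemma sqrt_mandelstam_cm: "sqrt (mandelstam_s (cm_p P u) (cm_q P u)) = cm_sqrt_s u"
  by (simp add: mandelstam_s_def rel_momentum_cm cm_sqrt_s_def add.commute)

text \<open>For nonzero P the coefficient (\<gamma> - 1) / |P|^2 is \<open>cm_coeff\<close>, because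
  \<gamma> = E / sqrt s; at P = 0 both corrections vanish.\<close>

lemma boosted_direction_cm:
  assumes "norm \<omega> = 1"
  shows "norm u *\<^sub>R boosted_direction (cm_p P u) (cm_q P u) \<omega> = cm_boost P (norm u *\<^sub>R \<omega>)"
proof -
  have "cm_coeff P (norm u *\<^sub>R \<omega>) = cm_coeff P u"
    using assms by (intro cm_norm_cong) simp
  moreover have "(cm_energy P u / cm_sqrt_s u - 1) * ((P \<bullet> \<omega>) / (norm P)\<^sup>2) = (P \<bullet> \<omega>) * cm_coeff P u" if "P \<noteq> 0"
    unfolding cm_coeff_mult_norm[symmetric] using that by (simp add: dot_square_norm)
  ultimately show ?thesis
    by (cases "P = 0") (simp_all add: boosted_direction_def cm_boost_def cm_p_add_cm_q lorentz_gamma_def energy_cm_sum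
        sqrt_mandelstam_cm scaleR_right_distrib mult_ac)
qed

lemma post_cm:
  assumes "norm \<omega> = 1"
  shows post_p_cm: "post_p (cm_p P u) (cm_q P u) \<omega> = cm_p P (norm u *\<^sub>R \<omega>)"
    and post_q_cm: "post_q (cm_p P u) (cm_q P u) \<omega> = cm_q P (norm u *\<^sub>R \<omega>)"
proof -
  have "(norm u / 2) *\<^sub>R boosted_direction (cm_p P u) (cm_q P u) \<omega> = (1/2) *\<^sub>R cm_boost P (norm u *\<^sub>R \<omega>)"
    using boosted_direction_cm[OF assms, of u P, symmetric] by simp
  then show "post_p (cm_p P u) (cm_q P u) \<omega> = cm_p P (norm u *\<^sub>R \<omega>)"
       "post_q (cm_p P u) (cm_q P u) \<omega> = cm_q P (norm u *\<^sub>R \<omega>)"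
    unfolding post_p_def post_q_def rel_momentum_cm cm_p_add_cm_q
    by (simp_all only: cm_p_def[of _ "norm u *\<^sub>R \<omega>"] cm_q_def[of _ "norm u *\<^sub>R \<omega>"]
         scaleR_right_distrib scaleR_right_diff_distrib)
qed

text \<open>The numerator is the Minkowski product of the relative four-momenta before and after the
  collision, so it may be computed in the centre-of-mass frame, where the time components
  vanish.\<close>

lemma cos_scattering_cm:
  assumes "norm \<omega> = 1"
  shows "cos_scattering (cm_p P u) (cm_q P u) \<omega> = (u \<bullet> \<omega>) / norm u"
proof -
  let ?v = "norm u *\<^sub>R \<omega>"
  have n: "norm u = norm ?v" using assms by simp
  have "- (P \<bullet> u / cm_sqrt_s u) * (P \<bullet> ?v / cm_sqrt_s ?v) + cm_boost P u \<bullet> cm_boost P ?v = u \<bullet> ?v"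
    unfolding cm_boost_inner_cm_boost[OF n] by (simp add: cm_norm_cong(1)[OF n] power2_eq_square)
  then have "cos_scattering (cm_p P u) (cm_q P u) \<omega> = (u \<bullet> ?v) / (norm u)\<^sup>2"
    unfolding cos_scattering_def post_cm[OF assms] energy_cm_diff cm_p_diff_cm_q rel_momentum_cm
    by simp
  then show ?thesis by (simp add: power2_eq_square)
qed

text \<open>The preimage is found by boosting the relative four-momentum (P.w / E, w), with w = p -
  q, back to the centre-of-mass frame.\<close>

lemma cm_p_surj:
  fixes p q :: "real^3"
  obtains u where "p = cm_p (p + q) u" "q = cm_q (p + q) u"
proof -
  define P w E where "P = p + q" and "w = p - q" and "E = energy p + energy q"
  have E_ge: "energy x \<ge> 1" for x by (simp add: energy_def)
  have E_pos: "E > 0" using E_ge[of p] E_ge[of q] by (simp add: E_def)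
  have e2: "(energy x)\<^sup>2 = 1 + x \<bullet> x" for x by (simp add: energy_def dot_square_norm)
  \<comment> \<open>The four-vectors of p + q and p - q are Minkowski-orthogonal, since both
    particles have mass 1.\<close>
  have Pw: "P \<bullet> w = E * (energy p - energy q)"
  proof -
    have "E * (energy p - energy q) = (energy p)\<^sup>2 - (energy q)\<^sup>2"
      by (simp add: E_def algebra_simps power2_eq_square)
    then show ?thesis by (simp add: e2 P_def w_def algebra_simps inner_commute)
  qed
  define g2 where "g2 = w \<bullet> w - (energy p - energy q)\<^sup>2"
  have g2': "g2 = w \<bullet> w - (P \<bullet> w)\<^sup>2 / E\<^sup>2"
    using E_pos by (simp add: g2_def Pw power_mult_distrib)
  have EP: "E\<^sup>2 = 4 + g2 + P \<bullet> P"
  proof -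
    have "E\<^sup>2 = 2 * (energy p)\<^sup>2 + 2 * (energy q)\<^sup>2 - (energy p - energy q)\<^sup>2"
      by (simp add: E_def power2_eq_square algebra_simps)
    then show ?thesis by (simp add: e2 g2_def P_def w_def algebra_simps inner_commute)
  qed
  \<comment> \<open>Here g^2 = 2 (p^0 q^0 - 1 - p.q), and the bracket is non-negative by
    Cauchy-Schwarz for (1, p) and (1, q).\<close>
  have g2_nn: "g2 \<ge> 0"
  proof -
    have "energy p * energy q \<ge> 1 + p \<bullet> q"
    proof -
      have "\<bar>1 + p \<bullet> q\<bar> \<le> norm (1::real, p) * norm (1::real, q)"
        using Cauchy_Schwarz_ineq2[of "(1::real,p)" "(1::real,q)"] by simp
      then show ?thesis by (simp add: norm_Pair energy_def)
    qed
    moreover have "g2 = 2 * (energy p * energy q) - 2 - 2 * (p \<bullet> q)"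
      using e2[of p] e2[of q]
      by (simp add: g2_def w_def power2_diff inner_diff_left inner_diff_right inner_commute) 
    ultimately show ?thesis by simp
  qed
  define S where "S = sqrt (4 + g2)"
  have S: "S > 0" "S\<^sup>2 = 4 + g2" using g2_nn by (auto simp: S_def add_pos_nonneg)
  \<comment> \<open>The inverse boost adds to w the multiple 1 / (S (E + S)) - 1 / (S E) = - y of
    (P.w) P, the second term coming from the time component.\<close>
  define y where "y = 1 / (E * (E + S))"
  define u where "u = w - ((P \<bullet> w) * y) *\<^sub>R P"
  have PP: "P \<bullet> P = (E - S) * (E + S)" using EP S by (simp add: algebra_simps power2_eq_square)
  have ES: "E + S > 0" using E_pos S by simp
  have yPP: "y * (P \<bullet> P) = (E - S) / E"
    using ES E_pos by (simp add: y_def PP)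
  have uu: "u \<bullet> u = g2"
  proof -
    have "u \<bullet> u = w \<bullet> w - (P \<bullet> w)\<^sup>2 * (2 * y - y * (y * (P \<bullet> P)))"
      by (simp add: u_def algebra_simps inner_commute power2_eq_square)
    also have "2 * y - y * (y * (P \<bullet> P)) = y * (E + S) / E"
      using E_pos by (simp add: yPP field_simps)
    also have "\<dots> = 1 / E\<^sup>2" using ES E_pos by (simp add: y_def power2_eq_square)
    finally show ?thesis by (simp add: g2')
  qed
  then have nu: "(norm u)\<^sup>2 = g2" by (simp add: dot_square_norm)
  have cs: "cm_sqrt_s u = S" by (simp add: cm_sqrt_s_def nu S_def)
  have ce: "cm_energy P u = E"
    unfolding cm_energy_def power2_norm_eq_inner uu EP[symmetric] using E_pos by simp
  have oP: "1 - y * (P \<bullet> P) = S / E"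
    unfolding yPP using E_pos by (simp add: field_simps)
  have "P \<bullet> u = (P \<bullet> w) * (1 - y * (P \<bullet> P))"
    unfolding u_def by (simp add: inner_diff_right right_diff_distrib)
  then have Pu: "P \<bullet> u = (P \<bullet> w) * (S / E)" by (simp only: oP)
  have "(S / E) * (1 / (S * (E + S))) = y"
    unfolding y_def using S(1) by simp
  then have "(P \<bullet> u) * cm_coeff P u = (P \<bullet> w) * y"
    unfolding cm_coeff_def cs ce Pu by (simp only: mult.assoc)
  then have w: "cm_boost P u = w" unfolding cm_boost_def by (simp only:) (simp add: u_def)
  have "p = cm_p P u" "q = cm_q P u"
    unfolding cm_p_def cm_q_def w by (simp_all add: P_def w_def vec_eq_iff)
  then show ?thesis using that unfolding P_def by blast
qed

text \<open>With P fixed, p determines q, and the pair determines |u| as its g; the inner product of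
  p - q with P then gives P.u, and so u itself. Surjectivity is the inverse boost.\<close>

lemma bij_cm_p: "bij (cm_p P)"
proof (rule bijI)
  show "inj (cm_p P)"
  proof (rule injI)
    fix u v assume eq: "cm_p P u = cm_p P v"
    have q: "cm_q P u = cm_q P v"
      using eq cm_p_add_cm_q[of P u] cm_p_add_cm_q[of P v] by (metis add_left_cancel)
    then have n: "norm u = norm v"
      using eq rel_momentum_cm[of P u] rel_momentum_cm[of P v] by simp
    have b: "cm_boost P u = cm_boost P v"
      using eq q by (metis cm_p_diff_cm_q)
    have "cm_energy P v / cm_sqrt_s v \<noteq> 0" using cm_energy_pos[of P v] cm_sqrt_s_pos[of v] by simp
    then have "P \<bullet> u = P \<bullet> v"
      using b inner_cm_boost[of P u] inner_cm_boost[of P v] cm_norm_cong[OF n]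
      by (metis mult_left_cancel)
    then show "u = v"
      using b by (simp add: cm_boost_def cm_norm_cong[OF n])
  qed
  show "surj (cm_p P)"
    unfolding surj_def
  proof
    fix p
    show "\<exists>u. p = cm_p P u" using cm_p_surj[of p "P - p"] by (metis diff_add_cancel add.commute)
  qed
qed

section \<open>The Jacobian\<close>

text \<open>Lebesgue measure is determined by its values on boxes, and the Jacobian integrated over
  the preimage of a box gives the volume of the box.\<close>

lemma distr_density_bijection:
  fixes g :: "real^'n::{finite,wellorder} \<Rightarrow> real^'n::_"
  assumes der: "\<And>x. (g has_derivative g' x) (at x)" and bij: "bij g"
    and D: "D \<in> borel_measurable borel" "\<And>x. \<bar>det (matrix (g' x))\<bar> = D x"
  shows "distr (density lborel (\<lambda>x. ennreal (D x))) borel g = lborel"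
proof (rule lborel_eqI[symmetric])
  have cont: "continuous_on UNIV g"
    using has_derivative_continuous[OF der] by (simp add: continuous_on_eq_continuous_at)
  then have g[measurable]: "g \<in> borel_measurable borel" by (rule borel_measurable_continuous_onI)
  note D(1)[measurable]
  fix l u :: "real^'n::_"
  assume lu: "\<And>b. b \<in> Basis \<Longrightarrow> l \<bullet> b \<le> u \<bullet> b"
  let ?S = "g -` box l u"
  have S: "?S \<in> sets borel" using measurable_sets_borel[OF g, of "box l u"] by simp
  have im: "g ` ?S = box l u" using bij by (simp add: bij_is_surj surj_image_vimage_eq)
  have "((\<lambda>x. \<bar>det (matrix (g' x))\<bar>) has_integral (measure lebesgue (box l u))) ?S"
    using has_measure_differentiable_image[of ?S g g' "measure lebesgue (box l u)"] S im bij
    by (auto intro: has_derivative_at_withinI[OF der] inj_on_subset[OF bij_is_inj])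
  then have "(D has_integral (measure lebesgue (box l u))) ?S" by (simp add: D(2))
  then have "(\<integral>\<^sup>+x. ennreal (D x) * indicator ?S x \<partial>lborel) = ennreal (measure lebesgue (box l u))"
    by (rule nn_integral_has_integral_lebesgue'[rotated]) (simp flip: D(2))
  then show "emeasure (distr (density lborel (\<lambda>x. ennreal (D x))) borel g) (box l u) = (\<Prod>b\<in>Basis. (u - l) \<bullet> b)"
    using S lu emeasure_lborel_box[OF lu] emeasure_lborel_box_finite[of l u]
    by (simp add: emeasure_distr emeasure_density measure_def)
qed simp

lemma nn_integral_change_of_variables:
  fixes g :: "real^'n::{finite,wellorder} \<Rightarrow> real^'n::_"
  assumes der: "\<And>x. (g has_derivative g' x) (at x)" and bij: "bij g"
    and D: "D \<in> borel_measurable borel" "\<And>x. \<bar>det (matrix (g' x))\<bar> = D x"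
    and f[measurable]: "f \<in> borel_measurable borel"
  shows "(\<integral>\<^sup>+x. f x \<partial>lborel) = (\<integral>\<^sup>+x. ennreal (D x) * f (g x) \<partial>lborel)"
proof -
  have cont: "continuous_on UNIV g"
    using has_derivative_continuous[OF der] by (simp add: continuous_on_eq_continuous_at)
  then have [measurable]: "g \<in> borel_measurable borel" by (rule borel_measurable_continuous_onI)
  note D(1)[measurable]
  have "(\<integral>\<^sup>+x. f x \<partial>lborel) = (\<integral>\<^sup>+x. f x \<partial>distr (density lborel (\<lambda>x. ennreal (D x))) borel g)"
    by (simp add: distr_density_bijection[OF assms(1-4)])
  also have "\<dots> = (\<integral>\<^sup>+x. ennreal (D x) * f (g x) \<partial>lborel)"
    by (simp add: nn_integral_distr nn_integral_density)
  finally show ?thesis .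
qed

lemma has_derivative_cm_coeff:
  "(cm_coeff P has_derivative (\<lambda>v. - (u \<bullet> v) / (cm_energy P u * cm_sqrt_s u ^ 3))) (at u)"
proof -
  let ?S = "cm_sqrt_s u" and ?E = "cm_energy P u"
  have pos: "?S > 0" "?E > 0" "?E + ?S > 0"
    using cm_sqrt_s_pos[of u] cm_energy_pos[of P u] by simp_all
  have dS: "(cm_sqrt_s has_derivative (\<lambda>v. (u \<bullet> v) / ?S)) (at u)"
  proof -
    have "4 + u \<bullet> u > 0" by (simp add: add_pos_nonneg)
    then have "((\<lambda>u. sqrt (4 + u \<bullet> u)) has_derivative (\<lambda>v. (u \<bullet> v) / sqrt (4 + u \<bullet> u))) (at u)"
      by (auto intro!: derivative_eq_intros simp: inner_commute fun_eq_iff field_simps)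
    then show ?thesis by (simp add: cm_sqrt_s_def[abs_def] dot_square_norm)
  qed
  have dE: "(cm_energy P has_derivative (\<lambda>v. (u \<bullet> v) / ?E)) (at u)"
  proof -
    have "4 + u \<bullet> u + (norm P)\<^sup>2 > 0" by (simp add: add_pos_nonneg)
    then have "((\<lambda>u. sqrt (4 + u \<bullet> u + (norm P)\<^sup>2)) has_derivative (\<lambda>v. (u \<bullet> v) / sqrt (4 + u \<bullet> u + (norm P)\<^sup>2))) (at u)"
      by (auto intro!: derivative_eq_intros simp: inner_commute fun_eq_iff field_simps)
    then show ?thesis by (simp add: cm_energy_def[abs_def] dot_square_norm)
  qed
  have "((\<lambda>u. cm_sqrt_s u * (cm_energy P u + cm_sqrt_s u)) has_derivative
      (\<lambda>v. (u \<bullet> v) / ?S * (?E + ?S) + ?S * ((u \<bullet> v) / ?E + (u \<bullet> v) / ?S))) (at u)"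
    by (rule has_derivative_eq_rhs, (rule derivative_intros dS dE)+) (simp add: fun_eq_iff)
  from Deriv.has_derivative_inverse[OF _ this]
  have "(cm_coeff P has_derivative (\<lambda>v. - (((u \<bullet> v) / ?S * (?E + ?S) + ?S * ((u \<bullet> v) / ?E + (u \<bullet> v) / ?S)) / (?S * (?E + ?S))\<^sup>2))) (at u)"
    using pos by (simp add: cm_coeff_def[abs_def] divide_inverse power2_eq_square inverse_mult_distrib mult_ac)
  \<comment> \<open>The derivative of the denominator contains the factor (E + S)^2, which cancels
    against the squared denominator.\<close>
  moreover have "((u \<bullet> v) / ?S * (?E + ?S) + ?S * ((u \<bullet> v) / ?E + (u \<bullet> v) / ?S)) / (?S * (?E + ?S))\<^sup>2 = (u \<bullet> v) / (?E * ?S ^ 3)" for v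
  proof -
    have "(u \<bullet> v) / ?S * (?E + ?S) + ?S * ((u \<bullet> v) / ?E + (u \<bullet> v) / ?S) = (u \<bullet> v) / (?E * ?S) * (?E + ?S)\<^sup>2"
      using pos(1,2) by (simp add: field_simps power2_eq_square)
    then show ?thesis using pos by (simp add: power_mult_distrib power2_eq_square power3_eq_cube)
  qed
  ultimately show ?thesis by simp
qed

lemma has_derivative_cm_p:
  "(cm_p P has_derivative (\<lambda>v. (1/2) *\<^sub>R (v +
     ((P \<bullet> v) * cm_coeff P u - (P \<bullet> u) * ((u \<bullet> v) / (cm_energy P u * cm_sqrt_s u ^ 3))) *\<^sub>R P))) (at u)"
  unfolding cm_p_def[abs_def] cm_boost_def
  by (rule has_derivative_eq_rhs, (rule derivative_intros has_derivative_cm_coeff)+)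
     (auto simp: algebra_simps)

text \<open>The matrix determinant lemma det (I + P a^T) = 1 + a.P; the factor 1/2 contributes 1/8
  in three dimensions.\<close>

lemma det_scaled_rank_one_update:
  fixes a P :: "real^3"
  shows "det (matrix (\<lambda>v. (1/2) *\<^sub>R (v + (a \<bullet> v) *\<^sub>R P))) = (1 + a \<bullet> P) / 8"
  by (simp add: det_3 matrix_def inner_axis axis_def inner_vec_def sum_3 field_simps)

definition cm_jacobian :: "real^3 \<Rightarrow> real^3 \<Rightarrow> real" where
  "cm_jacobian P u = energy (cm_p P u) * energy (cm_q P u) / (2 * cm_energy P u * cm_sqrt_s u)"

lemma det_cm_p:
  "det (matrix (\<lambda>v. (1/2) *\<^sub>R (v +
     ((P \<bullet> v) * cm_coeff P u - (P \<bullet> u) * ((u \<bullet> v) / (cm_energy P u * cm_sqrt_s u ^ 3))) *\<^sub>R P)))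
   = cm_jacobian P u"
proof -
  let ?S = "cm_sqrt_s u" and ?E = "cm_energy P u"
  \<comment> \<open>The derivative is half of the identity plus the rank-one map v -> (a.v) P, from
    which \<open>?a\<close> is read off.\<close>
  let ?a = "cm_coeff P u *\<^sub>R P - ((P \<bullet> u) / (?E * ?S ^ 3)) *\<^sub>R u"
  have pos: "?S > 0" "?E > 0"
    using cm_sqrt_s_pos[of u] cm_energy_pos[of P u] by simp_all
  have "(P \<bullet> v) * cm_coeff P u - (P \<bullet> u) * ((u \<bullet> v) / (?E * ?S ^ 3)) = ?a \<bullet> v" for v
    by (simp add: algebra_simps)
  moreover have "1 + ?a \<bullet> P = ?E / ?S - (P \<bullet> u)\<^sup>2 / (?E * ?S ^ 3)"
    by (simp add: inner_diff_left cm_coeff_mult_norm inner_commute[of u] power2_eq_square)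
  \<comment> \<open>Multiplying the two energy formulas gives 4 p^0 q^0 = E^2 - (P.u)^2 / s.\<close>
  moreover have "\<dots> / 8 = cm_jacobian P u"
    using pos unfolding cm_jacobian_def energy_cm_p energy_cm_q
    by (simp add: field_simps power2_eq_square power3_eq_cube)
  ultimately show ?thesis by (simp add: det_scaled_rank_one_update)
qed

lemma energy_pos: "energy p > 0"
  by (simp add: energy_def add_pos_nonneg)

lemma cm_jacobian_pos: "cm_jacobian P u > 0"
  by (simp add: cm_jacobian_def energy_pos cm_energy_pos cm_sqrt_s_pos)

section \<open>Measurability of arccos and of the kinematic quantities\<close>

lemma borel_measurable_arccos [measurable]: "arccos \<in> borel_measurable borel"
proof -
  have "continuous_on UNIV (\<lambda>y::real. arccos (max (-1) (min 1 y)))"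
    by (intro continuous_on_arccos continuous_intros) auto
  then have [measurable]: "(\<lambda>y::real. arccos (max (-1) (min 1 y))) \<in> borel_measurable borel"
    by (rule borel_measurable_continuous_onI)
  \<comment> \<open>Outside [-1, 1] the description defining \<open>arccos\<close> is unsatisfiable,
    so its value there is one fixed number.\<close>
  have "arccos y = (if \<bar>y\<bar> \<le> 1 then arccos (max (-1) (min 1 y)) else (THE x. False))" for y
  proof (cases "\<bar>y\<bar> \<le> 1")
    case True
    then have "max (-1) (min 1 y) = y" by (simp add: abs_le_iff)
    with True show ?thesis by simp
  next
    case False
    then have "cos x \<noteq> y" for x using abs_cos_le_one[of x] by auto
    with False show ?thesis by (simp add: arccos_def)
  qed
  then have "arccos = (\<lambda>y. if \<bar>y\<bar> \<le> 1 then arccos (max (-1) (min 1 y)) else (THE x. False))"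
    by blast
  moreover have "\<dots> \<in> borel_measurable borel" by measurable
  ultimately show ?thesis by simp
qed

context
  fixes f g h :: "'a \<Rightarrow> real^3" and M
  assumes [measurable]: "f \<in> borel_measurable M" "g \<in> borel_measurable M" "h \<in> borel_measurable M"
begin

lemma measurable_energy [measurable (raw)]: "(\<lambda>x. energy (f x)) \<in> borel_measurable M"
  unfolding energy_def by measurable

lemma measurable_cm_sqrt_s [measurable (raw)]: "(\<lambda>x. cm_sqrt_s (f x)) \<in> borel_measurable M"
  unfolding cm_sqrt_s_def by measurable

lemma measurable_cm_energy [measurable (raw)]: "(\<lambda>x. cm_energy (f x) (g x)) \<in> borel_measurable M"
  unfolding cm_energy_def by measurable

end

context
  fixes f g h :: "'a \<Rightarrow> real^3" and M
  assumes [measurable]: "f \<in> borel_measurable M" "g \<in> borel_measurable M" "h \<in> borel_measurable M"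
begin

lemma measurable_cm_p [measurable (raw)]: "(\<lambda>x. cm_p (f x) (g x)) \<in> borel_measurable M"
  unfolding cm_p_def cm_boost_def cm_coeff_def by measurable

lemma measurable_cm_q [measurable (raw)]: "(\<lambda>x. cm_q (f x) (g x)) \<in> borel_measurable M"
  unfolding cm_q_def cm_boost_def cm_coeff_def by measurable

lemma measurable_rel_momentum [measurable (raw)]: "(\<lambda>x. rel_momentum (f x) (g x)) \<in> borel_measurable M"
  unfolding rel_momentum_def by measurable

lemma measurable_mandelstam_s [measurable (raw)]: "(\<lambda>x. mandelstam_s (f x) (g x)) \<in> borel_measurable M"
  unfolding mandelstam_s_def by measurable

end

context
  fixes f g h :: "'a \<Rightarrow> real^3" and M
  assumes [measurable]: "f \<in> borel_measurable M" "g \<in> borel_measurable M" "h \<in> borel_measurable M"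
begin

lemma measurable_moller_velocity [measurable (raw)]: "(\<lambda>x. moller_velocity (f x) (g x)) \<in> borel_measurable M"
  unfolding moller_velocity_def by measurable

lemma measurable_boosted_direction [measurable (raw)]: "(\<lambda>x. boosted_direction (f x) (g x) (h x)) \<in> borel_measurable M"
  unfolding boosted_direction_def lorentz_gamma_def by measurable

lemma measurable_cm_jacobian [measurable (raw)]: "(\<lambda>x. cm_jacobian (f x) (g x)) \<in> borel_measurable M"
  unfolding cm_jacobian_def by measurable

end

context
  fixes f g h :: "'a \<Rightarrow> real^3" and M
  assumes [measurable]: "f \<in> borel_measurable M" "g \<in> borel_measurable M" "h \<in> borel_measurable M"
begin

lemma measurable_post_p [measurable (raw)]: "(\<lambda>x. post_p (f x) (g x) (h x)) \<in> borel_measurable M"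
  unfolding post_p_def by measurable

lemma measurable_post_q [measurable (raw)]: "(\<lambda>x. post_q (f x) (g x) (h x)) \<in> borel_measurable M"
  unfolding post_q_def by measurable

end

context
  fixes f g h :: "'a \<Rightarrow> real^3" and M
  assumes [measurable]: "f \<in> borel_measurable M" "g \<in> borel_measurable M" "h \<in> borel_measurable M"
begin

lemma measurable_scattering_angle [measurable (raw)]: "(\<lambda>x. scattering_angle (f x) (g x) (h x)) \<in> borel_measurable M"
  unfolding scattering_angle_def cos_scattering_def by measurable

end

section \<open>Polar coordinates\<close>

text \<open>\<open>sphere_measure\<close> lives on the sphere as a subspace. Its image on the
  ambient space has the full Borel sets and fits into products with Lebesgue measure; unit length
  becomes an almost-everywhere statement.\<close>

definition sphere_borel :: "(real^3) measure" where
  "sphere_borel = distr sphere_measure borel (\<lambda>\<omega>. \<omega>)"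

lemma sets_sphere_borel [measurable_cong, simp]: "sets sphere_borel = sets borel"
  and space_sphere_borel [simp]: "space sphere_borel = UNIV"
  by (simp_all add: sphere_borel_def)

lemma sphere_measure_to_borel: "(\<lambda>\<omega>. \<omega>) \<in> sphere_measure \<rightarrow>\<^sub>M borel"
proof -
  have "sets sphere_measure = sets (restrict_space borel (sphere 0 1))"
    by (simp add: sphere_measure_def)
  moreover have "(\<lambda>\<omega>::real^3. \<omega>) \<in> restrict_space borel (sphere 0 1) \<rightarrow>\<^sub>M borel"
    by (rule measurable_restrict_space1) simp
  ultimately show ?thesis by (simp cong: measurable_cong_sets)
qed

lemma finite_measure_sphere_borel: "finite_measure sphere_borel"
proof
  have "emeasure sphere_borel UNIV = ennreal (4 * pi)"
    using emeasure_sphere_measure_total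
    by (simp add: sphere_borel_def emeasure_distr[OF sphere_measure_to_borel])
  then show "emeasure sphere_borel (space sphere_borel) \<noteq> \<infinity>"
    by simp
qed

interpretation sphere_borel: finite_measure sphere_borel
  by (rule finite_measure_sphere_borel)

lemma nn_integral_sphere_measure:
  assumes "f \<in> borel_measurable borel"
  shows "(\<integral>\<^sup>+\<omega>. f \<omega> \<partial>sphere_measure) = (\<integral>\<^sup>+\<omega>. f \<omega> \<partial>sphere_borel)"
  using assms by (simp add: sphere_borel_def nn_integral_distr[OF sphere_measure_to_borel])

lemma AE_sphere_measure: "(AE \<omega> in sphere_borel. P \<omega>) \<Longrightarrow> (AE \<omega> in sphere_measure. P \<omega>)"
  unfolding sphere_borel_def by (rule AE_distrD[OF sphere_measure_to_borel])

lemma AE_sphere_borel_norm: "AE \<omega> in sphere_borel. norm \<omega> = 1"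
  unfolding sphere_borel_def
  by (subst AE_distr_iff[OF sphere_measure_to_borel]) auto

lemma nn_integral_sphere_borel:
  assumes f[measurable]: "f \<in> borel_measurable borel"
  shows "(\<integral>\<^sup>+\<omega>. f \<omega> \<partial>sphere_borel) = 3 * (\<integral>\<^sup>+v. f (v /\<^sub>R norm v) * indicator (ball 0 1) v \<partial>lborel)"
proof -
  have "f \<in> borel_measurable (restrict_space borel (sphere 0 1))"
    by (rule measurable_restrict_space1) simp
  then have "(\<integral>\<^sup>+\<omega>. f \<omega> \<partial>sphere_borel) = 3 * (\<integral>\<^sup>+v. f (v /\<^sub>R norm v) \<partial>restrict_space lborel (ball 0 1 - {0}))"
    unfolding nn_integral_sphere_measure[OF f, symmetric]
    by (simp add: sphere_measure_def nn_integral_scale_measure nn_integral_distr[OF normalize_measurable_sphere])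
  also have "(\<integral>\<^sup>+v. f (v /\<^sub>R norm v) \<partial>restrict_space lborel (ball 0 1 - {0}))
    = (\<integral>\<^sup>+v. f (v /\<^sub>R norm v) * indicator (ball 0 1 - {0}) v \<partial>lborel)"
    by (rule nn_integral_restrict_space) simp
  \<comment> \<open>The origin may be put back, being a null set.\<close>
  also have "\<dots> = (\<integral>\<^sup>+v. f (v /\<^sub>R norm v) * indicator (ball 0 1) v \<partial>lborel)"
    by (rule nn_integral_cong_AE, use AE_lborel_singleton[of "0::real^3"] in eventually_elim)
       (auto simp: indicator_def)
  finally show ?thesis .
qed

lemma emeasure_sphere_borel:
  assumes [measurable]: "A \<in> sets borel"
  shows "emeasure sphere_borel A = 3 * emeasure lborel {v. norm v < 1 \<and> v /\<^sub>R norm v \<in> A}"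
proof -
  have "emeasure sphere_borel A = (\<integral>\<^sup>+\<omega>. indicator A \<omega> \<partial>sphere_borel)"
    by (simp add: nn_integral_indicator)
  also have "\<dots> = 3 * (\<integral>\<^sup>+v. indicator A (v /\<^sub>R norm v) * indicator (ball 0 1) v \<partial>lborel)"
    by (rule nn_integral_sphere_borel) simp
  also have "(\<integral>\<^sup>+v. indicator A (v /\<^sub>R norm v) * indicator (ball 0 1) v \<partial>lborel)
      = (\<integral>\<^sup>+v. indicator {v. norm v < 1 \<and> v /\<^sub>R norm v \<in> A} v \<partial>(lborel :: (real^3) measure))"
    by (rule nn_integral_cong) (auto simp: indicator_def)
  also have "\<dots> = emeasure lborel {v. norm v < 1 \<and> v /\<^sub>R norm v \<in> A}"
    by (rule nn_integral_indicator) measurable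
  finally show ?thesis .
qed

text \<open>Dilation by r multiplies volume by r^3 and leaves v / |v| unchanged.\<close>

lemma emeasure_cone:
  assumes [measurable]: "A \<in> sets borel" and r: "0 < r"
  shows "emeasure lborel {v::real^3. norm v < r \<and> v /\<^sub>R norm v \<in> A}
    = ennreal (r ^ 3) * emeasure lborel {v::real^3. norm v < 1 \<and> v /\<^sub>R norm v \<in> A}"
proof -
  have "(lborel :: (real^3) measure) = density (distr lborel borel (\<lambda>x. 0 + r *\<^sub>R x)) (\<lambda>_. \<bar>r\<bar>^DIM(real^3))"
    using r by (intro lborel_affine) simp
  then have L: "(lborel :: (real^3) measure) = density (distr lborel borel (\<lambda>x. r *\<^sub>R x)) (\<lambda>_. ennreal (r^3))"
    using r by (simp add: DIM_cart)
  have cancel: "inverse r * inverse (norm x) * r = inverse (norm x)" for x :: "real^3"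
    using r by simp
  have "emeasure lborel {v::real^3. norm v < r \<and> v /\<^sub>R norm v \<in> A}
     = (\<integral>\<^sup>+v. indicator {v::real^3. norm v < r \<and> v /\<^sub>R norm v \<in> A} v \<partial>lborel)"
    by (rule nn_integral_indicator[symmetric]) measurable
  also have "\<dots> = (\<integral>\<^sup>+v. ennreal (r^3) * indicator {v::real^3. norm v < r \<and> v /\<^sub>R norm v \<in> A} (r *\<^sub>R v) \<partial>lborel)"
    by (subst L) (simp add: nn_integral_density nn_integral_distr del: nn_integral_indicator)
  also have "\<dots> = (\<integral>\<^sup>+v. ennreal (r^3) * indicator {v::real^3. norm v < 1 \<and> v /\<^sub>R norm v \<in> A} v \<partial>lborel)"
    using r by (intro nn_integral_cong) (auto simp: cancel indicator_def mult_less_cancel_left2 pos_less_divide_eq)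
  also have "\<dots> = ennreal (r ^ 3) * emeasure lborel {v::real^3. norm v < 1 \<and> v /\<^sub>R norm v \<in> A}"
    by (subst nn_integral_cmult) (simp_all add: nn_integral_indicator)
  finally show ?thesis .
qed

text \<open>
  The law of \<open>\<bar>u\<bar>\<close> takes the place of \<open>4 \<pi> r\<^sup>2 dr\<close>, whence the factor \<open>4 \<pi>\<close> in the product formulas below.
\<close>

definition radial_measure :: "real measure" where
  "radial_measure = distr (lborel :: (real^3) measure) borel norm"

lemma sets_radial_measure [measurable_cong, simp]: "sets radial_measure = sets borel"
  and space_radial_measure [simp]: "space radial_measure = UNIV"
  by (simp_all add: radial_measure_def)

lemma emeasure_radial_lessThan: 
  "emeasure radial_measure {..<r} = ennreal (4 / 3 * pi * (max 0 r) ^ 3)"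
proof -
  have "emeasure radial_measure {..<r} = emeasure lborel (ball (0::real^3) r)"
    by (simp add: radial_measure_def emeasure_distr vimage_def ball_def)
  then show ?thesis
    by (cases "0 \<le> r") (simp_all add: emeasure_ball unit_ball_vol_3 max_def DIM_cart mult_ac ball_empty)
qed

lemma sigma_finite_radial_measure: "sigma_finite_measure radial_measure"
proof
  show "\<exists>A. countable A \<and> A \<subseteq> sets radial_measure \<and> \<Union> A = space radial_measure \<and>
     (\<forall>a\<in>A. emeasure radial_measure a \<noteq> \<infinity>)"
    by (rule exI[of _ "range (\<lambda>n::nat. {..<real n})"])
       (auto simp: emeasure_radial_lessThan intro: reals_Archimedean2)
qed

interpretation radial_measure: sigma_finite_measure radial_measure
  by (rule sigma_finite_radial_measure)

text \<open>For fixed \<open>A\<close> both sides are measures in \<open>X\<close>, so it suffices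
  to compare them on the rays \<open>{..<r}\<close>. If m is the volume of the unit cone over
  \<open>A\<close>, scaling gives (4/3) pi r^3 times 3 m on the left and 4 pi times r^3 m on the
  right.\<close>

lemma radial_sphere_rectangle:
  assumes A[measurable]: "A \<in> sets borel" and X[measurable]: "X \<in> sets borel"
  shows "emeasure radial_measure X * emeasure sphere_borel A
    = ennreal (4 * pi) * emeasure lborel {v::real^3. norm v \<in> X \<and> v /\<^sub>R norm v \<in> A}"
proof -
  let ?M = "density radial_measure (\<lambda>_. emeasure sphere_borel A)"
  let ?N = "density (distr (density lborel (indicator {v::real^3. v /\<^sub>R norm v \<in> A})) borel norm) (\<lambda>_. ennreal (4 * pi))"
  have N: "emeasure ?N X = ennreal (4 * pi) * emeasure lborel {v::real^3. norm v \<in> X \<and> v /\<^sub>R norm v \<in> A}"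
    if [measurable]: "X \<in> sets borel" for X
  proof -
    have [measurable]: "norm -` X \<in> sets (borel :: (real^3) measure)"
      using measurable_sets_borel[of norm borel X] by simp
    have "emeasure ?N X = ennreal (4 * pi) * emeasure (density lborel (indicator {v::real^3. v /\<^sub>R norm v \<in> A})) (norm -` X)"
      by (simp add: emeasure_density_const emeasure_distr)
    also have "\<dots> = ennreal (4 * pi) * (\<integral>\<^sup>+v. indicator {v. v /\<^sub>R norm v \<in> A} v * indicator X (norm v) \<partial>(lborel :: (real^3) measure))"
      by (simp add: emeasure_density indicator_vimage)
    also have "(\<integral>\<^sup>+v. indicator {v. v /\<^sub>R norm v \<in> A} v * indicator X (norm v) \<partial>(lborel :: (real^3) measure))
       = (\<integral>\<^sup>+v. indicator {v. norm v \<in> X \<and> v /\<^sub>R norm v \<in> A} v \<partial>(lborel :: (real^3) measure))"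
      by (rule nn_integral_cong) (auto simp: indicator_def)
    also have "\<dots> = emeasure lborel {v. norm v \<in> X \<and> v /\<^sub>R norm v \<in> A}"
      by (rule nn_integral_indicator) measurable
    finally show ?thesis .
  qed
  have M: "emeasure ?M X = emeasure radial_measure X * emeasure sphere_borel A" if [measurable]: "X \<in> sets borel" for X
    by (simp add: emeasure_density_const mult.commute)
  have "?M = ?N"
  proof (rule measure_eqI_generator_eq[where E="range lessThan" and \<Omega>=UNIV and A="\<lambda>n. {..<real n}"])
    show "Int_stable (range (lessThan :: real \<Rightarrow> _))"
    proof (clarsimp simp: Int_stable_def)
      fix a b :: real
      have "{..<a} \<inter> {..<b} = {..<min a b}" by auto
      then show "{..<a} \<inter> {..<b} \<in> range lessThan" by simp
    qed
    have *: "sets borel = sigma_sets UNIV (range (lessThan :: real \<Rightarrow> _))"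
      by (subst borel_Iio) simp
    show "sets ?M = sigma_sets UNIV (range lessThan)" "sets ?N = sigma_sets UNIV (range lessThan)"
      using * by simp_all
    show "(\<Union>n. {..<real n}) = UNIV" by (auto intro: reals_Archimedean2)
    show "emeasure ?M {..<real n} \<noteq> \<infinity>" for n
      by (simp add: M emeasure_radial_lessThan ennreal_mult_eq_top_iff)
    fix Y :: "real set" assume "Y \<in> range lessThan"
    then obtain r where Y: "Y = {..<r}" by auto
    show "emeasure ?M Y = emeasure ?N Y"
    proof (cases "0 < r")
      case True
      have "emeasure ?N Y = ennreal (4 * pi) * (ennreal (r ^ 3) * emeasure lborel {v::real^3. norm v < 1 \<and> v /\<^sub>R norm v \<in> A})"
        by (simp add: N Y emeasure_cone[OF A True])
      moreover have "emeasure ?M Y = ennreal (4/3 * pi * r^3) * (3 * emeasure lborel {v::real^3. norm v < 1 \<and> v /\<^sub>R norm v \<in> A})"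
        unfolding Y using True by (subst M) (simp_all add: emeasure_radial_lessThan emeasure_sphere_borel)
      moreover have "ennreal (4 * pi) * ennreal (r ^ 3) = ennreal (4/3 * pi * r^3) * ennreal 3"
        using True by (subst (1 2) ennreal_mult[symmetric]) (auto simp: field_simps)
      ultimately show ?thesis by (simp add: mult.assoc[symmetric])
    next
      \<comment> \<open>For r \<le> 0 both sides are zero, since norms are non-negative.\<close>
      case False
      then have none: "\<not> norm v < r" for v :: "real^3" by (simp add: not_less order_trans[OF _ norm_ge_zero])
      have "emeasure ?N Y = 0" unfolding Y by (subst N) (simp_all add: none)
      moreover have "emeasure ?M Y = 0"
        unfolding Y using False by (subst M) (simp_all add: emeasure_radial_lessThan max_def)
      ultimately show ?thesis by simp
    qed
  qed auto
  then show ?thesis using M[OF X] N[OF X] by simp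
qed

text \<open>Rectangles determine a product of \<sigma>-finite measures; on them the image of
  Lebesgue measure under (norm, direction), times 4 pi, agrees with the product by
  \<open>radial_sphere_rectangle\<close>.\<close>

lemma nn_integral_polar:
  assumes f[measurable]: "f \<in> borel_measurable (borel \<Otimes>\<^sub>M borel)"
  shows "ennreal (4 * pi) * (\<integral>\<^sup>+u. f (norm u, u /\<^sub>R norm u) \<partial>lborel)
     = (\<integral>\<^sup>+r. (\<integral>\<^sup>+\<omega>. f (r, \<omega>) \<partial>sphere_borel) \<partial>radial_measure)"
proof -
  let ?T = "\<lambda>u::real^3. (norm u, u /\<^sub>R norm u)"
  let ?N = "density (distr lborel (borel \<Otimes>\<^sub>M borel) ?T) (\<lambda>_. ennreal (4 * pi))"
  have "radial_measure \<Otimes>\<^sub>M sphere_borel = ?N"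
  proof (rule pair_measure_eqI)
    show "sets (radial_measure \<Otimes>\<^sub>M sphere_borel) = sets ?N"
      by (simp cong: sets_pair_measure_cong)
    fix X :: "real set" and A :: "(real^3) set"
    assume "X \<in> sets radial_measure" "A \<in> sets sphere_borel"
    then have [measurable]: "X \<in> sets borel" "A \<in> sets borel" by simp_all
    have "?T -` (X \<times> A) = {v. norm v \<in> X \<and> v /\<^sub>R norm v \<in> A}" by auto
    moreover have "emeasure ?N (X \<times> A) = ennreal (4 * pi) * emeasure (distr lborel (borel \<Otimes>\<^sub>M borel) ?T) (X \<times> A)"
      by (simp add: emeasure_density nn_integral_cmult)
    ultimately have "emeasure ?N (X \<times> A) = ennreal (4 * pi) * emeasure lborel {v. norm v \<in> X \<and> v /\<^sub>R norm v \<in> A}"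
      by (simp add: emeasure_distr)
    then show "emeasure radial_measure X * emeasure sphere_borel A = emeasure ?N (X \<times> A)"
      by (simp add: radial_sphere_rectangle)
  qed (unfold_locales)
  then have "(\<integral>\<^sup>+z. f z \<partial>(radial_measure \<Otimes>\<^sub>M sphere_borel)) = (\<integral>\<^sup>+z. f z \<partial>?N)" by simp
  also have "\<dots> = ennreal (4 * pi) * (\<integral>\<^sup>+u. f (?T u) \<partial>lborel)"
    by (simp add: nn_integral_density nn_integral_cmult nn_integral_distr)
  also have "(\<integral>\<^sup>+z. f z \<partial>(radial_measure \<Otimes>\<^sub>M sphere_borel)) = (\<integral>\<^sup>+r. (\<integral>\<^sup>+\<omega>. f (r, \<omega>) \<partial>sphere_borel) \<partial>radial_measure)"
    by (rule sphere_borel.nn_integral_fst[symmetric]) simp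
  finally show ?thesis by simp
qed

text \<open>In polar coordinates u = r n both sides become integrals over r and two independent
  directions n, \<omega> with the same measure, which Fubini exchanges.\<close>

lemma nn_integral_direction_swap:
  assumes f[measurable]: "f \<in> borel_measurable (borel \<Otimes>\<^sub>M borel)"
  shows "(\<integral>\<^sup>+u. (\<integral>\<^sup>+\<omega>. f (u, norm u *\<^sub>R \<omega>) \<partial>sphere_borel) \<partial>lborel)
       = (\<integral>\<^sup>+u. (\<integral>\<^sup>+\<omega>. f (norm u *\<^sub>R \<omega>, u) \<partial>sphere_borel) \<partial>lborel)"
proof -
  interpret pair_sigma_finite sphere_borel sphere_borel by unfold_locales
  \<comment> \<open>This also holds at u = 0, so the norm times the direction always gives back
    u.\<close>
  have u: "(norm u * inverse (norm u)) *\<^sub>R u = u" for u :: "real^3" by (cases "u = 0") simp_all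
  have "ennreal (4 * pi) * (\<integral>\<^sup>+u. (\<integral>\<^sup>+\<omega>. f (u, norm u *\<^sub>R \<omega>) \<partial>sphere_borel) \<partial>lborel)
    = (\<integral>\<^sup>+r. (\<integral>\<^sup>+n. (\<integral>\<^sup>+\<omega>. f (r *\<^sub>R n, r *\<^sub>R \<omega>) \<partial>sphere_borel) \<partial>sphere_borel) \<partial>radial_measure)"
    using nn_integral_polar[of "\<lambda>(r, n). \<integral>\<^sup>+\<omega>. f (r *\<^sub>R n, r *\<^sub>R \<omega>) \<partial>sphere_borel"] by (simp add: u)
  also have "\<dots> = (\<integral>\<^sup>+r. (\<integral>\<^sup>+n. (\<integral>\<^sup>+\<omega>. f (r *\<^sub>R \<omega>, r *\<^sub>R n) \<partial>sphere_borel) \<partial>sphere_borel) \<partial>radial_measure)"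
    by (intro nn_integral_cong Fubini') measurable
  also have "\<dots> = ennreal (4 * pi) * (\<integral>\<^sup>+u. (\<integral>\<^sup>+\<omega>. f (norm u *\<^sub>R \<omega>, u) \<partial>sphere_borel) \<partial>lborel)"
    using nn_integral_polar[of "\<lambda>(r, n). \<integral>\<^sup>+\<omega>. f (r *\<^sub>R \<omega>, r *\<^sub>R n) \<partial>sphere_borel"] by (simp add: u)
  finally show ?thesis
    by (simp add: ennreal_mult_cancel_left)
qed

section \<open>Symmetry of the collision measure\<close>

text \<open>For fixed p the shift q -> p + q preserves Lebesgue measure; after Fubini the variable p
  is replaced by u at fixed P.\<close>

lemma nn_integral_cm:
  assumes f[measurable]: "f \<in> borel_measurable (borel \<Otimes>\<^sub>M borel)"
  shows "(\<integral>\<^sup>+p. (\<integral>\<^sup>+q. f (p, q) \<partial>lborel) \<partial>lborel)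
    = (\<integral>\<^sup>+P. (\<integral>\<^sup>+u. ennreal (cm_jacobian P u) * f (cm_p P u, cm_q P u) \<partial>lborel) \<partial>lborel)"
proof -
  have "(\<integral>\<^sup>+p. (\<integral>\<^sup>+q. f (p, q) \<partial>lborel) \<partial>lborel) = (\<integral>\<^sup>+p. (\<integral>\<^sup>+P. f (p, P - p) \<partial>lborel) \<partial>lborel)"
  proof (rule nn_integral_cong)
    fix p :: "real^3"
    have "(\<integral>\<^sup>+q. f (p, q) \<partial>lborel) = (\<integral>\<^sup>+q. f (p, q) \<partial>distr lborel borel ((+) (- p)))"
      by (simp add: lborel_distr_plus)
    also have "\<dots> = (\<integral>\<^sup>+P. f (p, P - p) \<partial>lborel)"
      by (simp add: nn_integral_distr)
    finally show "(\<integral>\<^sup>+q. f (p, q) \<partial>lborel) = (\<integral>\<^sup>+P. f (p, P - p) \<partial>lborel)" .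
  qed
  also have "\<dots> = (\<integral>\<^sup>+P. (\<integral>\<^sup>+p. f (p, P - p) \<partial>lborel) \<partial>lborel)"
    by (rule lborel_pair.Fubini') measurable
  also have "\<dots> = (\<integral>\<^sup>+P. (\<integral>\<^sup>+u. ennreal (cm_jacobian P u) * f (cm_p P u, cm_q P u) \<partial>lborel) \<partial>lborel)"
  proof (rule nn_integral_cong)
    fix P :: "real^3"
    have "P - cm_p P u = cm_q P u" for u
      using cm_p_add_cm_q[of P u] by (metis add_diff_cancel_left')
    then show "(\<integral>\<^sup>+p. f (p, P - p) \<partial>lborel) = (\<integral>\<^sup>+u. ennreal (cm_jacobian P u) * f (cm_p P u, cm_q P u) \<partial>lborel)"
      by (subst nn_integral_change_of_variables[OF has_derivative_cm_p[where P=P] bij_cm_p[where P=P], where D="cm_jacobian P"])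
         (simp_all only: det_cm_p abs_of_pos[OF cm_jacobian_pos], simp_all)
  qed
  finally show ?thesis .
qed

text \<open>The weight 1 / (p^0 q^0) cancels the energies in the Jacobian. What remains, 1 / (2 E
  sqrt s), depends on u only through |u| and so is the same before and after the collision.\<close>

lemma nn_integral_collision:
  assumes f[measurable]: "f \<in> borel_measurable ((borel \<Otimes>\<^sub>M borel) \<Otimes>\<^sub>M (borel \<Otimes>\<^sub>M borel))"
  shows "(\<integral>\<^sup>+p. (\<integral>\<^sup>+q. (\<integral>\<^sup>+\<omega>. ennreal (1 / (energy p * energy q)) *
        f ((p, q), (post_p p q \<omega>, post_q p q \<omega>)) \<partial>sphere_borel) \<partial>lborel) \<partial>lborel)
    = (\<integral>\<^sup>+P. (\<integral>\<^sup>+u. (\<integral>\<^sup>+\<omega>. ennreal (1 / (2 * cm_energy P u * cm_sqrt_s u)) *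
        f ((cm_p P u, cm_q P u), (cm_p P (norm u *\<^sub>R \<omega>), cm_q P (norm u *\<^sub>R \<omega>))) \<partial>sphere_borel) \<partial>lborel) \<partial>lborel)"
    (is "?L = ?R")
proof -
  have "?L = (\<integral>\<^sup>+P. (\<integral>\<^sup>+u. ennreal (cm_jacobian P u) *
      (\<integral>\<^sup>+\<omega>. ennreal (1 / (energy (cm_p P u) * energy (cm_q P u))) *
        f ((cm_p P u, cm_q P u), (post_p (cm_p P u) (cm_q P u) \<omega>, post_q (cm_p P u) (cm_q P u) \<omega>))
       \<partial>sphere_borel) \<partial>lborel) \<partial>lborel)"
    using nn_integral_cm[of "\<lambda>(p, q). \<integral>\<^sup>+\<omega>. ennreal (1 / (energy p * energy q)) *
        f ((p, q), (post_p p q \<omega>, post_q p q \<omega>)) \<partial>sphere_borel"] by simp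
  also have "\<dots> = ?R"
  proof (intro nn_integral_cong)
    fix P u :: "real^3"
    have w: "ennreal (cm_jacobian P u) * (ennreal (1 / (energy (cm_p P u) * energy (cm_q P u))) * x) =
        ennreal (1 / (2 * cm_energy P u * cm_sqrt_s u)) * x" for x
    proof -
      have "cm_jacobian P u * (1 / (energy (cm_p P u) * energy (cm_q P u))) = 1 / (2 * cm_energy P u * cm_sqrt_s u)"
        using energy_pos[of "cm_p P u"] energy_pos[of "cm_q P u"] by (simp add: cm_jacobian_def)
      then show ?thesis
        using cm_jacobian_pos[of P u] energy_pos[of "cm_p P u"] energy_pos[of "cm_q P u"]
        by (simp only: mult.assoc[symmetric] ennreal_mult[symmetric] less_imp_le zero_le_divide_1_iff mult_nonneg_nonneg)
    qed
    have "ennreal (cm_jacobian P u) *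
      (\<integral>\<^sup>+\<omega>. ennreal (1 / (energy (cm_p P u) * energy (cm_q P u))) *
        f ((cm_p P u, cm_q P u), (post_p (cm_p P u) (cm_q P u) \<omega>, post_q (cm_p P u) (cm_q P u) \<omega>)) \<partial>sphere_borel)
      = (\<integral>\<^sup>+\<omega>. ennreal (1 / (2 * cm_energy P u * cm_sqrt_s u)) *
        f ((cm_p P u, cm_q P u), (post_p (cm_p P u) (cm_q P u) \<omega>, post_q (cm_p P u) (cm_q P u) \<omega>)) \<partial>sphere_borel)"
      by (subst nn_integral_cmult[symmetric]) (simp_all add: w)
    also have "\<dots> = (\<integral>\<^sup>+\<omega>. ennreal (1 / (2 * cm_energy P u * cm_sqrt_s u)) *
        f ((cm_p P u, cm_q P u), (cm_p P (norm u *\<^sub>R \<omega>), cm_q P (norm u *\<^sub>R \<omega>))) \<partial>sphere_borel)"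
      by (rule nn_integral_cong_AE, use AE_sphere_borel_norm in eventually_elim) (simp add: post_cm)
    finally show "ennreal (cm_jacobian P u) *
      (\<integral>\<^sup>+\<omega>. ennreal (1 / (energy (cm_p P u) * energy (cm_q P u))) *
        f ((cm_p P u, cm_q P u), (post_p (cm_p P u) (cm_q P u) \<omega>, post_q (cm_p P u) (cm_q P u) \<omega>)) \<partial>sphere_borel)
      = (\<integral>\<^sup>+\<omega>. ennreal (1 / (2 * cm_energy P u * cm_sqrt_s u)) *
        f ((cm_p P u, cm_q P u), (cm_p P (norm u *\<^sub>R \<omega>), cm_q P (norm u *\<^sub>R \<omega>))) \<partial>sphere_borel)" .
  qed
  finally show ?thesis .
qed

text \<open>In centre-of-mass coordinates, exchanging the two pairs means exchanging u with |u|
  \<omega>, which \<open>nn_integral_direction_swap\<close> allows for each P.\<close>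

lemma collision_symmetry:
  assumes f[measurable]: "f \<in> borel_measurable ((borel \<Otimes>\<^sub>M borel) \<Otimes>\<^sub>M (borel \<Otimes>\<^sub>M borel))"
  shows "(\<integral>\<^sup>+p. (\<integral>\<^sup>+q. (\<integral>\<^sup>+\<omega>. ennreal (1 / (energy p * energy q)) *
        f ((p, q), (post_p p q \<omega>, post_q p q \<omega>)) \<partial>sphere_borel) \<partial>lborel) \<partial>lborel)
    = (\<integral>\<^sup>+p. (\<integral>\<^sup>+q. (\<integral>\<^sup>+\<omega>. ennreal (1 / (energy p * energy q)) *
        f ((post_p p q \<omega>, post_q p q \<omega>), (p, q)) \<partial>sphere_borel) \<partial>lborel) \<partial>lborel)"
proof -
  have "(\<integral>\<^sup>+u. (\<integral>\<^sup>+\<omega>. ennreal (1 / (2 * cm_energy P u * cm_sqrt_s u)) *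
        f ((cm_p P u, cm_q P u), (cm_p P (norm u *\<^sub>R \<omega>), cm_q P (norm u *\<^sub>R \<omega>))) \<partial>sphere_borel) \<partial>lborel)
     = (\<integral>\<^sup>+u. (\<integral>\<^sup>+\<omega>. ennreal (1 / (2 * cm_energy P u * cm_sqrt_s u)) *
        f ((cm_p P (norm u *\<^sub>R \<omega>), cm_q P (norm u *\<^sub>R \<omega>)), (cm_p P u, cm_q P u)) \<partial>sphere_borel) \<partial>lborel)" for P
  proof -
    have "(\<integral>\<^sup>+u. (\<integral>\<^sup>+\<omega>. ennreal (1 / (2 * cm_energy P u * cm_sqrt_s u)) *
        f ((cm_p P u, cm_q P u), (cm_p P (norm u *\<^sub>R \<omega>), cm_q P (norm u *\<^sub>R \<omega>))) \<partial>sphere_borel) \<partial>lborel)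
     = (\<integral>\<^sup>+u. (\<integral>\<^sup>+\<omega>. ennreal (1 / (2 * cm_energy P (norm u *\<^sub>R \<omega>) * cm_sqrt_s (norm u *\<^sub>R \<omega>))) *
        f ((cm_p P (norm u *\<^sub>R \<omega>), cm_q P (norm u *\<^sub>R \<omega>)), (cm_p P u, cm_q P u)) \<partial>sphere_borel) \<partial>lborel)"
      using nn_integral_direction_swap[of "\<lambda>(u, v). ennreal (1 / (2 * cm_energy P u * cm_sqrt_s u)) *
        f ((cm_p P u, cm_q P u), (cm_p P v, cm_q P v))"] by simp
    also have "\<dots> = (\<integral>\<^sup>+u. (\<integral>\<^sup>+\<omega>. ennreal (1 / (2 * cm_energy P u * cm_sqrt_s u)) *
        f ((cm_p P (norm u *\<^sub>R \<omega>), cm_q P (norm u *\<^sub>R \<omega>)), (cm_p P u, cm_q P u)) \<partial>sphere_borel) \<partial>lborel)"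
    proof (rule nn_integral_cong, rule nn_integral_cong_AE, use AE_sphere_borel_norm in eventually_elim)
      fix u \<omega> :: "real^3" assume "norm \<omega> = 1"
      then have "norm (norm u *\<^sub>R \<omega>) = norm u" by simp
      from cm_norm_cong[OF this]
      show "ennreal (1 / (2 * cm_energy P (norm u *\<^sub>R \<omega>) * cm_sqrt_s (norm u *\<^sub>R \<omega>))) *
        f ((cm_p P (norm u *\<^sub>R \<omega>), cm_q P (norm u *\<^sub>R \<omega>)), (cm_p P u, cm_q P u)) =
        ennreal (1 / (2 * cm_energy P u * cm_sqrt_s u)) *
        f ((cm_p P (norm u *\<^sub>R \<omega>), cm_q P (norm u *\<^sub>R \<omega>)), (cm_p P u, cm_q P u))" by simp
    qed
    finally show ?thesis .
  qed
  \<comment> \<open>The right-hand side takes the same form by \<open>nn_integral_collision\<close>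
    for f with its two pairs exchanged.\<close>
  then show ?thesis
    using nn_integral_collision[OF f] nn_integral_collision[of "\<lambda>(a, b). f (b, a)"] by simp
qed

lemma collision_cases:
  fixes p q :: "real^3"
  obtains P u where "P = p + q" "p = cm_p P u" "q = cm_q P u"
  using cm_p_surj by blast

lemma rel_momentum_post:
  assumes "norm \<omega> = 1"
  shows "rel_momentum (post_p p q \<omega>) (post_q p q \<omega>) = rel_momentum p q"
proof -
  obtain P u where "p = cm_p P u" "q = cm_q P u" by (rule collision_cases)
  then show ?thesis using assms by (simp add: post_cm rel_momentum_cm)
qed

section \<open>Integration over the sphere\<close>

lemma nn_integral_lborel_vec3:
  fixes f :: "3 \<Rightarrow> real \<Rightarrow> ennreal"
  assumes [measurable]: "\<And>i. f i \<in> borel_measurable borel"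
  shows "(\<integral>\<^sup>+x. f 1 (x $ 1) * f 2 (x $ 2) * f 3 (x $ 3) \<partial>(lborel :: (real^3) measure))
    = (\<integral>\<^sup>+x. f 1 x \<partial>lborel) * (\<integral>\<^sup>+x. f 2 x \<partial>lborel) * (\<integral>\<^sup>+x. f 3 x \<partial>lborel)"
proof -
  \<comment> \<open>The product formula indexes its factors by basis vectors; the description
    recovers i from \<open>axis i 1\<close>.\<close>
  let ?F = "\<lambda>b. f (THE i. b = axis i (1::real))"
  have the: "(THE i. axis j (1::real) = axis i 1) = j" for j :: 3
    by (rule the_equality) (auto simp: axis_eq_axis)
  have B: "(Basis :: (real^3) set) = (\<lambda>i. axis i 1) ` UNIV" by (auto simp: Basis_vec_def)
  have inj: "inj (\<lambda>i. axis i (1::real) :: real^3)" by (auto simp: inj_def axis_eq_axis)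
  have P: "(\<Prod>b\<in>Basis. g b) = g (axis 1 1) * g (axis 2 1) * g (axis 3 1)" for g :: "real^3 \<Rightarrow> ennreal"
  proof -
    have "(\<Prod>b\<in>Basis. g b) = (\<Prod>i\<in>(UNIV::3 set). g (axis i 1))"
      unfolding B by (subst prod.reindex[OF inj]) simp
    then show ?thesis unfolding UNIV_3 by (simp add: mult.assoc)
  qed
  have "(\<integral>\<^sup>+x. (\<Prod>b\<in>Basis. ?F b (x \<bullet> b)) \<partial>lborel) = (\<Prod>b\<in>Basis. (\<integral>\<^sup>+x. ?F b x \<partial>lborel))"
    by (rule nn_integral_lborel_prod) simp_all
  then show ?thesis by (simp add: P the inner_axis)
qed

text \<open>Up to normalisation the integrand is the normal density of variance 1 / a.\<close>

lemma nn_integral_gaussian: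
  assumes "a > 0"
  shows "(\<integral>\<^sup>+x. ennreal (exp (- a / 2 * x\<^sup>2)) \<partial>lborel) = ennreal (sqrt (2 * pi / a))"
proof -
  have "(\<integral>\<^sup>+x. ennreal (normal_density 0 (1 / sqrt a) x) \<partial>lborel) = 1"
    using assms by (subst nn_integral_eq_integral) auto
  moreover have "ennreal (exp (- a / 2 * x\<^sup>2)) = ennreal (sqrt (2 * pi / a)) * ennreal (normal_density 0 (1 / sqrt a) x)" for x
    using assms by (subst ennreal_mult[symmetric]) (auto simp: normal_density_def power_divide)
  ultimately show ?thesis by (simp add: nn_integral_cmult)
qed

lemma nn_integral_orthogonal_transformation:
  fixes f :: "real^'n::{finite,wellorder} \<Rightarrow> real^'n::_" 
  assumes f: "orthogonal_transformation f" and g: "g \<in> borel_measurable borel"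
  shows "(\<integral>\<^sup>+x. g (f x) \<partial>lborel) = (\<integral>\<^sup>+x. g x \<partial>lborel)"
proof -
  have "linear f" using f by (simp add: orthogonal_transformation_def)
  then have d: "(f has_derivative f) (at x)" for x
    by (simp add: linear_imp_has_derivative)
  show ?thesis
    using nn_integral_change_of_variables[OF d orthogonal_transformation_bij[OF f], where D="\<lambda>_. 1" and f=g]
      orthogonal_transformation_det[OF f] g by simp
qed

text \<open>
  For a unit vector \<open>e\<close> and \<open>t = e \<bullet> \<omega>\<close> we have \<open>1 - t \<ge> (1 - t\<^sup>2) / 2\<close>; in the cone over the sphere
  this leaves a Gaussian in the two directions orthogonal to \<open>e\<close>.
\<close>

lemma nn_integral_sphere_exp_le:
  fixes e :: "real^3"
  assumes a: "a > 0" and e: "norm e = 1"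
  shows "(\<integral>\<^sup>+\<omega>. ennreal (exp (a * (e \<bullet> \<omega>))) \<partial>sphere_borel) \<le> ennreal (12 * pi * exp a / a)"
proof -
  \<comment> \<open>The cutoff along e keeps the integral of this bound finite, as the Gaussian does
    not decay in that direction.\<close>
  let ?G = "\<lambda>v::real^3. ennreal (exp (- a / 2 * ((norm v)\<^sup>2 - (e \<bullet> v)\<^sup>2))) * indicator {-1..1} (e \<bullet> v)"
  obtain R :: "real^3 \<Rightarrow> real^3" where R: "orthogonal_transformation R" "R (axis 3 1) = e"
    using orthogonal_transformation_exists_1[of "axis 3 1" e] e by auto
  have "(\<integral>\<^sup>+\<omega>. ennreal (exp (a * (e \<bullet> \<omega>))) \<partial>sphere_borel)
    = 3 * (\<integral>\<^sup>+v. ennreal (exp (a * (e \<bullet> (v /\<^sub>R norm v)))) * indicator (ball 0 1) v \<partial>lborel)"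
    by (rule nn_integral_sphere_borel) simp
  also have "\<dots> \<le> 3 * (\<integral>\<^sup>+v. ennreal (exp a) * ?G v \<partial>lborel)"
  proof (intro mult_left_mono nn_integral_mono)
    fix v :: "real^3"
    show "ennreal (exp (a * (e \<bullet> (v /\<^sub>R norm v)))) * indicator (ball 0 1) v \<le> ennreal (exp a) * ?G v"
    proof (cases "norm v < 1")
      case True
      have ev: "\<bar>e \<bullet> v\<bar> \<le> norm v" using Cauchy_Schwarz_ineq2[of e v] e by simp
      define t where "t = e \<bullet> (v /\<^sub>R norm v)"
      have "\<bar>t\<bar> \<le> norm e * norm (v /\<^sub>R norm v)" unfolding t_def by (rule Cauchy_Schwarz_ineq2)
      also have "\<dots> \<le> 1" using e by (cases "v = 0") auto
      finally have t: "\<bar>t\<bar> \<le> 1" .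
      have evt: "e \<bullet> v = t * norm v" by (cases "v = 0") (auto simp: t_def)
      \<comment> \<open>With e.v = t |v|, the quantity |v|^2 - (e.v)^2 equals |v|^2 (1 - t^2), which
        is at most 1 - t^2 in the unit ball.\<close>
      have "(norm v)\<^sup>2 \<le> 1" using True by (simp add: power_le_one)
      moreover have "0 \<le> 1 - t\<^sup>2" using t by (simp add: abs_square_le_1)
      ultimately have "(norm v)\<^sup>2 * (1 - t\<^sup>2) \<le> 1 * (1 - t\<^sup>2)"
        by (intro mult_right_mono)
      also have "\<dots> \<le> 2 * (1 - t)"
        using zero_le_power2[of "1 - t"] by (simp add: power2_eq_square algebra_simps)
      finally have "(norm v)\<^sup>2 - (e \<bullet> v)\<^sup>2 \<le> 2 * (1 - t)"
        by (simp add: evt power_mult_distrib algebra_simps)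
      then have "a / 2 * ((norm v)\<^sup>2 - (e \<bullet> v)\<^sup>2) \<le> a / 2 * (2 * (1 - t))"
        using a by (intro mult_left_mono) auto
      then have "a * t \<le> a + (- a / 2 * ((norm v)\<^sup>2 - (e \<bullet> v)\<^sup>2))"
        by (simp add: algebra_simps)
      then have "exp (a * t) \<le> exp a * exp (- a / 2 * ((norm v)\<^sup>2 - (e \<bullet> v)\<^sup>2))"
        unfolding exp_add[symmetric] by simp
      moreover have "e \<bullet> v \<in> {-1..1}" using ev True by auto
      ultimately show ?thesis
        using True by (simp add: t_def ennreal_mult[symmetric] del: ennreal_mult)
    qed simp
  qed simp
  \<comment> \<open>Rotating e to the third axis turns the integrand into a product over the
    coordinates.\<close>
  also have "(\<integral>\<^sup>+v. ennreal (exp a) * ?G v \<partial>lborel) = ennreal (exp a) * (\<integral>\<^sup>+v. ?G (R v) \<partial>lborel)"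
    by (subst nn_integral_orthogonal_transformation[OF R(1)]) (simp_all add: nn_integral_cmult)
  also have "(\<integral>\<^sup>+v. ?G (R v) \<partial>lborel) = (\<integral>\<^sup>+v. ennreal (exp (- a / 2 * (v $ 1)\<^sup>2)) * ennreal (exp (- a / 2 * (v $ 2)\<^sup>2))
      * indicator {-1..1} (v $ 3) \<partial>(lborel :: (real^3) measure))"
  proof (rule nn_integral_cong)
    fix v :: "real^3"
    have "e \<bullet> R v = v $ 3"
    proof -
      have "e \<bullet> R v = axis 3 1 \<bullet> v"
        using R(1) unfolding R(2)[symmetric] orthogonal_transformation_def by blast
      then show ?thesis by (simp add: inner_axis')
    qed
    moreover have "norm (R v) = norm v" using R(1) by (rule orthogonal_transformation_norm)
    moreover have "(norm v)\<^sup>2 = (v $ 1)\<^sup>2 + (v $ 2)\<^sup>2 + (v $ 3)\<^sup>2"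
      unfolding power2_norm_eq_inner by (simp add: inner_vec_def sum_3 power2_eq_square)
    ultimately show "?G (R v) = ennreal (exp (- a / 2 * (v $ 1)\<^sup>2)) * ennreal (exp (- a / 2 * (v $ 2)\<^sup>2))
      * indicator {-1..1} (v $ 3)"
      by (simp add: ennreal_mult[symmetric] exp_add[symmetric] algebra_simps del: ennreal_mult)
  qed
  also have "\<dots> = ennreal (sqrt (2 * pi / a)) * ennreal (sqrt (2 * pi / a)) * 2"
    using nn_integral_lborel_vec3[of "\<lambda>i x. if i = 3 then indicator {-1..1} x else ennreal (exp (- a / 2 * x\<^sup>2))"]
      nn_integral_gaussian[OF a] by simp
  \<comment> \<open>The factors are 3 from the cone measure, 2 pi / a from the two Gaussians and 2
    from the cutoff interval.\<close>
  also have "3 * (ennreal (exp a) * (ennreal (sqrt (2 * pi / a)) * ennreal (sqrt (2 * pi / a)) * 2)) = ennreal (12 * pi * exp a / a)"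
  proof -
    have "ennreal (sqrt (2 * pi / a)) * ennreal (sqrt (2 * pi / a)) = ennreal (2 * pi / a)"
      using a by (subst ennreal_mult[symmetric]) auto
    moreover have "ennreal 3 * (ennreal (exp a) * (ennreal (2 * pi / a) * ennreal 2)) = ennreal (12 * pi * exp a / a)"
      using a by (simp only: ennreal_mult[symmetric] exp_ge_zero mult_nonneg_nonneg divide_nonneg_nonneg pi_ge_zero less_imp_le zero_le_numeral) (simp add: field_simps)
    ultimately show ?thesis by simp
  qed
  finally show ?thesis .
qed

text \<open>Since |u| \<le> sqrt s, Cauchy-Schwarz gives 4 p^0 q^0 = E^2 - (P.u)^2 / s \<ge> E^2 -
  |P|^2 = s.\<close>

lemma cm_sqrt_s_le: "(cm_sqrt_s u)\<^sup>2 \<le> 4 * (energy (cm_p P u) * energy (cm_q P u))"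
proof -
  let ?S = "cm_sqrt_s u" and ?E = "cm_energy P u"
  have "(P \<bullet> u)\<^sup>2 \<le> (P \<bullet> P) * (u \<bullet> u)" by (rule Cauchy_Schwarz_ineq)
  also have "\<dots> \<le> (P \<bullet> P) * ?S\<^sup>2"
    by (intro mult_left_mono) (auto simp: cm_sqrt_s_sq dot_square_norm)
  finally have "(P \<bullet> u)\<^sup>2 / ?S\<^sup>2 \<le> P \<bullet> P"
    using cm_sqrt_s_pos[of u] by (simp add: divide_le_eq)
  moreover have "4 * (energy (cm_p P u) * energy (cm_q P u)) = ?E\<^sup>2 - (P \<bullet> u)\<^sup>2 / ?S\<^sup>2"
    using cm_sqrt_s_pos[of u] by (simp add: energy_cm_p energy_cm_q field_simps power2_eq_square)
  ultimately show ?thesis by (simp add: cm_energy_sq)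
qed

text \<open>Factoring out exp (k E / 2) leaves the exponential integral over the sphere with
  parameter a = k |P| |u| / (2 sqrt s). Its exp a is absorbed by a second factor exp (k E / 2),
  because |P| |u| \<le> E sqrt s.\<close>

lemma nn_integral_exp_post_energy_le:
  fixes P u :: "real^3"
  assumes k: "k > 0" and P: "P \<noteq> 0" and u: "u \<noteq> 0"
  shows "(\<integral>\<^sup>+\<omega>. ennreal (exp_weight k (post_p (cm_p P u) (cm_q P u) \<omega>)) \<partial>sphere_borel)
    \<le> ennreal (24 * pi * cm_sqrt_s u * exp (k * cm_energy P u) / (k * norm P * norm u))"
proof -
  let ?S = "cm_sqrt_s u" and ?E = "cm_energy P u"
  define a where "a = k * norm P * norm u / (2 * ?S)"
  define e where "e = P /\<^sub>R norm P"
  have S: "?S > 0" by (rule cm_sqrt_s_pos)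
  have a: "a > 0" using k P u S by (simp add: a_def)
  have e: "norm e = 1" using P by (simp add: e_def)
  have "norm P * norm u \<le> ?E * ?S"
    by (intro mult_mono) (auto simp: cm_energy_def cm_sqrt_s_def intro!: real_le_rsqrt)
  then have "a \<le> k * ?E / 2"
    using k S by (simp add: a_def divide_le_eq mult.assoc)
  have "(\<integral>\<^sup>+\<omega>. ennreal (exp_weight k (post_p (cm_p P u) (cm_q P u) \<omega>)) \<partial>sphere_borel)
     = (\<integral>\<^sup>+\<omega>. ennreal (exp (k * ?E / 2)) * ennreal (exp (a * (e \<bullet> \<omega>))) \<partial>sphere_borel)"
  proof (rule nn_integral_cong_AE, use AE_sphere_borel_norm in eventually_elim)
    fix \<omega> :: "real^3" assume \<omega>: "norm \<omega> = 1"
    then have n: "norm (norm u *\<^sub>R \<omega>) = norm u" by simp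
    have "k * energy (post_p (cm_p P u) (cm_q P u) \<omega>) = k * (?E / 2) + k * (norm u * (P \<bullet> \<omega>) / (2 * ?S))"
      by (simp add: post_cm[OF \<omega>] energy_cm_p cm_norm_cong[OF n] distrib_left)
    also have "k * (norm u * (P \<bullet> \<omega>) / (2 * ?S)) = a * (e \<bullet> \<omega>)"
      using P by (simp add: a_def e_def)
    finally show "ennreal (exp_weight k (post_p (cm_p P u) (cm_q P u) \<omega>))
       = ennreal (exp (k * ?E / 2)) * ennreal (exp (a * (e \<bullet> \<omega>)))"
      by (simp add: exp_weight_def exp_add ennreal_mult)
  qed
  also have "\<dots> = ennreal (exp (k * ?E / 2)) * (\<integral>\<^sup>+\<omega>. ennreal (exp (a * (e \<bullet> \<omega>))) \<partial>sphere_borel)"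
    by (rule nn_integral_cmult) simp
  also have "\<dots> \<le> ennreal (exp (k * ?E / 2)) * ennreal (12 * pi * exp a / a)"
    by (intro mult_left_mono nn_integral_sphere_exp_le a e) simp
  also have "\<dots> \<le> ennreal (exp (k * ?E / 2)) * ennreal (12 * pi * exp (k * ?E / 2) / a)"
    using \<open>a \<le> _\<close> a by (intro mult_left_mono ennreal_leI divide_right_mono) auto
  also have "\<dots> = ennreal (12 * pi * exp (k * ?E) / a)"
  proof -
    have "exp (k * ?E) = exp (k * ?E / 2) * exp (k * ?E / 2)" by (simp flip: exp_add)
    then show ?thesis using a by (subst ennreal_mult[symmetric]) (auto simp: mult_ac)
  qed
  also have "12 * pi * exp (k * ?E) / a = 24 * pi * ?S * exp (k * ?E) / (k * norm P * norm u)"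
    using k P u S by (simp add: a_def field_simps)
  finally show ?thesis .
qed

text \<open>After one factor |u| cancels, the power counting |u| s \<le> 8 (p^0 q^0)^(3/2) follows
  from |u| \<le> sqrt s and s \<le> 4 p^0 q^0. The exponential splits because E = p^0 + q^0.\<close>

lemma gain_kernel_bound:
  fixes p q :: "real^3"
  assumes k: "k > 0" and c: "c \<ge> 0" and pq: "p + q \<noteq> 0"
  shows "ennreal (c / (4 * pi) * (rel_momentum p q)\<^sup>2 * sqrt (mandelstam_s p q) / (energy p * energy q)) *
      (\<integral>\<^sup>+\<omega>. ennreal (exp_weight k (post_p p q \<omega>)) \<partial>sphere_borel)
    \<le> ennreal (48 * c / k) * ennreal (sqrt (energy p) * exp_weight k p / norm (p + q))
        * ennreal (sqrt (energy q) * exp_weight k q)"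
proof -
  obtain P u where Pu: "P = p + q" and cm: "cm_p P u = p" "cm_q P u = q" by (metis collision_cases)
  note rel = rel_momentum_cm[of P u, unfolded cm] and ms = sqrt_mandelstam_cm[of P u, unfolded cm]
  let ?S = "cm_sqrt_s u" and ?E = "cm_energy P u"
  show ?thesis
  proof (cases "u = 0")
    \<comment> \<open>If u = 0 then g = 0 and the left-hand side vanishes; the other case may divide
      by |u|.\<close>
    case True
    then show ?thesis by (simp add: rel)
  next
    case False
    define m where "m = energy p * energy q"
    have m: "m > 0" by (simp add: m_def energy_pos)
    have S: "?S > 0" by (rule cm_sqrt_s_pos)
    have P: "P \<noteq> 0" using pq Pu by simp
    have S2: "?S\<^sup>2 \<le> 4 * m" using cm_sqrt_s_le[of u P, unfolded cm] by (simp add: m_def)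
    have "norm u \<le> ?S" by (auto simp: cm_sqrt_s_def intro!: real_le_rsqrt)
    also have "?S \<le> 2 * sqrt m" using real_le_rsqrt[OF S2] by (simp add: real_sqrt_mult)
    finally have nu: "norm u \<le> 2 * sqrt m" .
    have "norm u * ?S\<^sup>2 \<le> 2 * sqrt m * (4 * m)"
      using nu S2 m by (intro mult_mono) auto
    then have u_le: "norm u * ?S\<^sup>2 / m \<le> 8 * sqrt m" using m by (simp add: divide_le_eq)
    have ex: "exp (k * ?E) = exp_weight k p * exp_weight k q"
      using energy_cm_sum[of P u, unfolded cm] by (simp add: exp_weight_def flip: exp_add distrib_left)
    have "ennreal (c / (4 * pi) * (norm u)\<^sup>2 * ?S / m) *
      (\<integral>\<^sup>+\<omega>. ennreal (exp_weight k (post_p p q \<omega>)) \<partial>sphere_borel)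
      \<le> ennreal (c / (4 * pi) * (norm u)\<^sup>2 * ?S / m) * ennreal (24 * pi * ?S * exp (k * ?E) / (k * norm P * norm u))"
      using nn_integral_exp_post_energy_le[OF k P False, unfolded cm] by (intro mult_left_mono) auto
    \<comment> \<open>The 6 is 24 pi / (4 pi); with the 8 from \<open>u_le\<close> it makes
      48.\<close>
    also have "\<dots> = ennreal (6 * c / (k * norm P) * exp (k * ?E) * (norm u * ?S\<^sup>2 / m))"
      using c k S m P False by (subst ennreal_mult[symmetric]) (auto simp: field_simps power2_eq_square)
    also have "\<dots> \<le> ennreal (6 * c / (k * norm P) * exp (k * ?E) * (8 * sqrt m))"
      using c k by (intro ennreal_leI mult_left_mono u_le) auto
    also have "6 * c / (k * norm P) * exp (k * ?E) * (8 * sqrt m)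
       = 48 * c / k * (sqrt (energy p) * exp_weight k p / norm P) * (sqrt (energy q) * exp_weight k q)"
      unfolding ex m_def real_sqrt_mult by simp
    also have "ennreal \<dots> = ennreal (48 * c / k) * ennreal (sqrt (energy p) * exp_weight k p / norm P)
        * ennreal (sqrt (energy q) * exp_weight k q)"
      using c k energy_pos[of p] energy_pos[of q]
      by (subst ennreal_mult; (subst ennreal_mult)?) (auto simp: exp_weight_def)
    finally show ?thesis
      unfolding rel ms m_def Pu .
  qed
qed

section \<open>Null sets and measurability\<close>

text \<open>
  The exceptional set is contained in the image of \<open>N \<times> \<real>\<close> under spherical coordinates around \<open>e\<close>.
\<close>

lemma null_set_polar_angle:
  fixes e :: "real^3"
  assumes N: "N \<in> null_sets (lborel :: (real \<times> real) measure)" and e: "norm e = 1"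
  shows "AE u in lborel. (norm u, arccos ((u \<bullet> e) / norm u)) \<notin> N"
proof -
  obtain R :: "real^3 \<Rightarrow> real^3" where R: "orthogonal_transformation R" "R (axis 3 1) = e"
    using orthogonal_transformation_exists_1[of "axis 3 1" e] e by auto
  have lin: "linear R" using R(1) by (simp add: orthogonal_transformation_def)
  define \<Phi> :: "(real \<times> real) \<times> real \<Rightarrow> real^3" where
    "\<Phi> = (\<lambda>z. (fst (fst z) * sin (snd (fst z)) * cos (snd z)) *\<^sub>R R (axis 1 1)
           + (fst (fst z) * sin (snd (fst z)) * sin (snd z)) *\<^sub>R R (axis 2 1)
           + (fst (fst z) * cos (snd (fst z))) *\<^sub>R e)"
  \<comment> \<open>A free azimuth raises the dimension to that of the target, and differentiable
    maps between spaces of equal dimension send null sets to null sets.\<close>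
  have "N \<times> UNIV \<in> null_sets (lborel \<Otimes>\<^sub>M (lborel :: real measure))"
    using N by (auto simp: null_sets_def lborel.emeasure_pair_measure_Times)
  then have "negligible (N \<times> (UNIV :: real set))"
    by (simp add: lborel_prod negligible_iff_null_sets null_sets_completionI)
  moreover have "\<Phi> differentiable_on N \<times> UNIV"
    unfolding differentiable_on_def differentiable_def
  proof
    fix z
    show "\<exists>D. (\<Phi> has_derivative D) (at z within N \<times> UNIV)"
      unfolding \<Phi>_def by (rule exI, (rule derivative_intros)+)
  qed
  ultimately have "negligible (\<Phi> ` (N \<times> UNIV))"
    by (intro negligible_differentiable_image_negligible) simp_all
  then have "AE u in lebesgue. u \<notin> \<Phi> ` (N \<times> UNIV)"
    unfolding negligible_iff_null_sets by (rule AE_not_in)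
  then have ae: "AE u in lborel. u \<notin> \<Phi> ` (N \<times> UNIV)"
    by (simp add: AE_completion_iff)
  have image: "u \<in> \<Phi> ` (N \<times> UNIV)" if u: "u \<noteq> 0" "(norm u, arccos ((u \<bullet> e) / norm u)) \<in> N" for u
  proof -
    obtain w where w: "u = R w" using orthogonal_transformation_surj[OF R(1)] by (metis surjD)
    define r \<theta> where "r = norm u" and "\<theta> = arccos ((u \<bullet> e) / norm u)"
    have r: "r > 0" using u by (simp add: r_def)
    have rw: "r\<^sup>2 = (w $ 1)\<^sup>2 + (w $ 2)\<^sup>2 + (w $ 3)\<^sup>2"
    proof -
      have "r\<^sup>2 = w \<bullet> w"
        using orthogonal_transformation_norm[OF R(1), of w] by (simp add: r_def w power2_norm_eq_inner)
      then show ?thesis by (simp add: inner_vec_def sum_3 power2_eq_square)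
    qed
    have ue: "u \<bullet> e = w $ 3"
    proof -
      have "u \<bullet> e = w \<bullet> axis 3 1"
        using R(1) unfolding w R(2)[symmetric] orthogonal_transformation_def by blast
      then show ?thesis by (simp add: inner_axis)
    qed
    have "\<bar>w $ 3\<bar> \<le> r" using Cauchy_Schwarz_ineq2[of u e] e by (simp add: r_def ue)
    then have "\<bar>w $ 3 / r\<bar> \<le> 1" using r by simp
    then have cos: "r * cos \<theta> = w $ 3"
      using r unfolding \<theta>_def ue r_def[symmetric] by (simp add: cos_arccos_abs)
    have "(r * sin \<theta>)\<^sup>2 = (w $ 1)\<^sup>2 + (w $ 2)\<^sup>2"
    proof -
      have "(r * sin \<theta>)\<^sup>2 + (r * cos \<theta>)\<^sup>2 = r\<^sup>2"
        by (simp add: power_mult_distrib flip: distrib_left)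
      then show ?thesis using rw by (simp add: cos)
    qed
    \<comment> \<open>The azimuth of w; on the axis, where r sin \<theta> = 0, the value 0 is
      taken.\<close>
    then obtain \<phi> where \<phi>: "w $ 1 = r * sin \<theta> * cos \<phi>" "w $ 2 = r * sin \<theta> * sin \<phi>"
    proof (cases "r * sin \<theta> = 0")
      case True
      with \<open>(r * sin \<theta>)\<^sup>2 = _\<close> have "w $ 1 = 0" "w $ 2 = 0" by (simp_all add: sum_power2_eq_zero_iff)
      then show ?thesis using that[of 0] True by simp
    next
      case False
      then have "(w $ 1 / (r * sin \<theta>))\<^sup>2 + (w $ 2 / (r * sin \<theta>))\<^sup>2 = 1"
        unfolding power_divide add_divide_distrib[symmetric] \<open>(r * sin \<theta>)\<^sup>2 = _\<close>[symmetric] by simp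
      then obtain t where "w $ 1 / (r * sin \<theta>) = cos t" "w $ 2 / (r * sin \<theta>) = sin t"
        by (rule sincos_total_2pi)
      then show ?thesis using that[of t] False by (simp add: field_simps)
    qed
    have "w = (w $ 1) *\<^sub>R axis 1 1 + (w $ 2) *\<^sub>R axis 2 1 + (w $ 3) *\<^sub>R axis 3 1"
      by (simp add: vec_eq_iff forall_3 axis_def)
    then have "u = R ((w $ 1) *\<^sub>R axis 1 1 + (w $ 2) *\<^sub>R axis 2 1 + (w $ 3) *\<^sub>R axis 3 1)"
      using w by simp
    also have "\<dots> = (w $ 1) *\<^sub>R R (axis 1 1) + (w $ 2) *\<^sub>R R (axis 2 1) + (w $ 3) *\<^sub>R R (axis 3 1)"
      by (simp only: linear_add[OF lin] linear_scale[OF lin])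
    also have "\<dots> = \<Phi> ((r, \<theta>), \<phi>)"
      unfolding \<Phi>_def R(2) \<phi> cos[symmetric] by simp
    finally have "u = \<Phi> ((r, \<theta>), \<phi>)" .
    then show ?thesis using u by (auto simp: r_def \<theta>_def)
  qed
  show ?thesis
    using ae AE_lborel_singleton[of "0::real^3"] by eventually_elim (use image in blast)
qed

text \<open>Tonelli moves p outside x, and the strictly positive weight turns a vanishing integral
  into failure of \<open>Q\<close>. This order of quantifiers suits an essential supremum over x at
  fixed p.\<close>

lemma AE_collision_null:
  fixes Q :: "real \<times> (real^3) \<times> (real^3) \<times> (real^3) \<Rightarrow> bool"
  assumes Q[measurable]: "Measurable.pred (borel \<Otimes>\<^sub>M borel \<Otimes>\<^sub>M borel \<Otimes>\<^sub>M borel) Q"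
    and null: "AE x in lborel. (\<integral>\<^sup>+p. (\<integral>\<^sup>+q. (\<integral>\<^sup>+\<omega>. ennreal (1 / (energy p * energy q)) *
        (if Q (x, p, q, \<omega>) then 1 else 0) \<partial>sphere_borel) \<partial>lborel) \<partial>lborel) = 0"
  shows "AE p in lborel. AE x in lborel. AE q in lborel. AE \<omega> in sphere_borel. \<not> Q (x, p, q, \<omega>)"
proof -
  let ?h = "\<lambda>x p q \<omega>. ennreal (1 / (energy p * energy q)) * (if Q (x, p, q, \<omega>) then 1 else 0)"
  have "(\<integral>\<^sup>+p. (\<integral>\<^sup>+x. (\<integral>\<^sup>+q. (\<integral>\<^sup>+\<omega>. ?h x p q \<omega> \<partial>sphere_borel) \<partial>lborel) \<partial>lborel) \<partial>lborel)
    = (\<integral>\<^sup>+x. (\<integral>\<^sup>+p. (\<integral>\<^sup>+q. (\<integral>\<^sup>+\<omega>. ?h x p q \<omega> \<partial>sphere_borel) \<partial>lborel) \<partial>lborel) \<partial>lborel)"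
    by (rule lborel_pair.Fubini') measurable
  also have "\<dots> = 0"
    using null by (subst nn_integral_0_iff_AE) simp_all
  finally have ae: "AE p in lborel. AE x in lborel. AE q in lborel. AE \<omega> in sphere_borel. ?h x p q \<omega> = 0"
    by (simp add: nn_integral_0_iff_AE)
  have "?h x p q \<omega> = 0 \<longleftrightarrow> \<not> Q (x, p, q, \<omega>)" for x p q \<omega>
    using energy_pos[of p] energy_pos[of q] by simp
  with ae show ?thesis by (simp only:)
qed

text \<open>By \<open>collision_symmetry\<close> the indicator of \<open>N\<close> at a
  post-collisional momentum has the same integral as at p or q, and that integral is zero for almost
  every x.\<close>

lemma AE_post_notin_null_set:
  assumes N: "N \<in> null_sets (lborel :: (real \<times> (real^3)) measure)"
  shows "AE p in lborel. AE x in lborel. AE q in lborel. AE \<omega> in sphere_borel. (x, post_p p q \<omega>) \<notin> N"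
    and "AE p in lborel. AE x in lborel. AE q in lborel. AE \<omega> in sphere_borel. (x, post_q p q \<omega>) \<notin> N"
proof -
  have [measurable]: "N \<in> sets borel" using N by auto
  have "AE z in lborel \<Otimes>\<^sub>M lborel. z \<notin> N" unfolding lborel_prod by (rule AE_not_in[OF N])
  then have N_ae: "AE x in lborel. AE p in lborel. (x, p) \<notin> N"
    by (rule lborel_pair.AE_pair)
  show "AE p in lborel. AE x in lborel. AE q in lborel. AE \<omega> in sphere_borel. (x, post_p p q \<omega>) \<notin> N"
  proof (rule AE_collision_null[of "\<lambda>(x, p, q, \<omega>). (x, post_p p q \<omega>) \<in> N", unfolded prod.case], measurable, use N_ae in eventually_elim)
    case (elim x)
    have "(\<integral>\<^sup>+p. (\<integral>\<^sup>+q. (\<integral>\<^sup>+\<omega>. ennreal (1 / (energy p * energy q)) *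
        (if (x, post_p p q \<omega>) \<in> N then 1 else 0) \<partial>sphere_borel) \<partial>lborel) \<partial>lborel)
      = (\<integral>\<^sup>+p. (\<integral>\<^sup>+q. (\<integral>\<^sup>+\<omega>. ennreal (1 / (energy p * energy q)) *
        (if (x, p) \<in> N then 1 else 0) \<partial>sphere_borel) \<partial>lborel) \<partial>lborel)"
    proof -
      have "(\<lambda>z. if (x, fst (snd z)) \<in> N then 1 else 0 :: ennreal)
          \<in> borel_measurable ((borel \<Otimes>\<^sub>M borel) \<Otimes>\<^sub>M (borel \<Otimes>\<^sub>M borel))"
        by measurable
      from collision_symmetry[OF this] show ?thesis by (simp only: fst_conv snd_conv)
    qed
    also have "\<dots> = (\<integral>\<^sup>+p. 0 \<partial>(lborel :: (real^3) measure))"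
      by (rule nn_integral_cong_AE) (use elim in eventually_elim, simp)
    finally show ?case by simp
  qed
  show "AE p in lborel. AE x in lborel. AE q in lborel. AE \<omega> in sphere_borel. (x, post_q p q \<omega>) \<notin> N"
  proof (rule AE_collision_null[of "\<lambda>(x, p, q, \<omega>). (x, post_q p q \<omega>) \<in> N", unfolded prod.case], measurable, use N_ae in eventually_elim)
    case (elim x)
    have "(\<integral>\<^sup>+p. (\<integral>\<^sup>+q. (\<integral>\<^sup>+\<omega>. ennreal (1 / (energy p * energy q)) *
        (if (x, post_q p q \<omega>) \<in> N then 1 else 0) \<partial>sphere_borel) \<partial>lborel) \<partial>lborel)
      = (\<integral>\<^sup>+p. (\<integral>\<^sup>+q. (\<integral>\<^sup>+\<omega>. ennreal (1 / (energy p * energy q)) *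
        (if (x, q) \<in> N then 1 else 0) \<partial>sphere_borel) \<partial>lborel) \<partial>lborel)"
    proof -
      have "(\<lambda>z. if (x, snd (snd z)) \<in> N then 1 else 0 :: ennreal)
          \<in> borel_measurable ((borel \<Otimes>\<^sub>M borel) \<Otimes>\<^sub>M (borel \<Otimes>\<^sub>M borel))"
        by measurable
      from collision_symmetry[OF this] show ?thesis by (simp only: fst_conv snd_conv)
    qed
    also have "\<dots> = (\<integral>\<^sup>+p. (\<integral>\<^sup>+q. 0 \<partial>(lborel :: (real^3) measure)) \<partial>(lborel :: (real^3) measure))"
      by (rule nn_integral_cong, rule nn_integral_cong_AE) (use elim in eventually_elim, simp)
    finally show ?case by simp
  qed
qed

text \<open>In centre-of-mass coordinates the pair is |u| and the angle between u and \<omega>, so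
  \<open>null_set_polar_angle\<close> applies with e = \<omega>. The dummy x matches the other
  exceptional sets.\<close>

lemma AE_scattering_notin_null_set:
  assumes N: "N \<in> null_sets (lborel :: (real \<times> real) measure)"
  shows "AE p in lborel. AE x in (lborel :: real measure). AE q in lborel. AE \<omega> in sphere_borel.
    (rel_momentum p q, scattering_angle p q \<omega>) \<notin> N"
proof (rule AE_collision_null[of "\<lambda>(x, p, q, \<omega>). (rel_momentum p q, scattering_angle p q \<omega>) \<in> N", unfolded prod.case])
  have [measurable]: "N \<in> sets borel" using N by auto
  show "Measurable.pred (borel \<Otimes>\<^sub>M borel \<Otimes>\<^sub>M borel \<Otimes>\<^sub>M borel)
     (\<lambda>(x::real, p, q, \<omega>). (rel_momentum p q, scattering_angle p q \<omega>) \<in> N)"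
    by measurable
  interpret pair_sigma_finite sphere_borel "lborel :: (real^3) measure" by unfold_locales
  have "AE \<omega> in sphere_borel. AE u in lborel. (norm u, arccos ((u \<bullet> \<omega>) / norm u)) \<notin> N"
    using AE_sphere_borel_norm by eventually_elim (rule null_set_polar_angle[OF N])
  then have "AE u in lborel. AE \<omega> in sphere_borel. (norm u, arccos ((u \<bullet> \<omega>) / norm u)) \<notin> N"
    by (subst (asm) AE_commute) measurable
  then have *: "AE u in lborel. (\<integral>\<^sup>+\<omega>. ennreal (1 / (energy (cm_p P u) * energy (cm_q P u))) *
        (if (rel_momentum (cm_p P u) (cm_q P u), scattering_angle (cm_p P u) (cm_q P u) \<omega>) \<in> N then 1 else 0) \<partial>sphere_borel) = 0" for P
  proof eventually_elim
    case (elim u)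
    have "(\<integral>\<^sup>+\<omega>. ennreal (1 / (energy (cm_p P u) * energy (cm_q P u))) *
        (if (rel_momentum (cm_p P u) (cm_q P u), scattering_angle (cm_p P u) (cm_q P u) \<omega>) \<in> N then 1 else 0) \<partial>sphere_borel)
      = (\<integral>\<^sup>+\<omega>. 0 \<partial>sphere_borel)"
      by (rule nn_integral_cong_AE, use elim AE_sphere_borel_norm in eventually_elim)
        (simp add: rel_momentum_cm scattering_angle_def cos_scattering_cm)
    then show ?case by simp
  qed
  have "(\<integral>\<^sup>+p. (\<integral>\<^sup>+q. (\<integral>\<^sup>+\<omega>. ennreal (1 / (energy p * energy q)) *
        (if (rel_momentum p q, scattering_angle p q \<omega>) \<in> N then 1 else 0) \<partial>sphere_borel) \<partial>lborel) \<partial>lborel)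
    = (\<integral>\<^sup>+P. (\<integral>\<^sup>+u. ennreal (cm_jacobian P u) * (\<integral>\<^sup>+\<omega>. ennreal (1 / (energy (cm_p P u) * energy (cm_q P u))) *
        (if (rel_momentum (cm_p P u) (cm_q P u), scattering_angle (cm_p P u) (cm_q P u) \<omega>) \<in> N then 1 else 0) \<partial>sphere_borel) \<partial>lborel) \<partial>lborel)"
    using nn_integral_cm[of "\<lambda>(p, q). \<integral>\<^sup>+\<omega>. ennreal (1 / (energy p * energy q)) *
        (if (rel_momentum p q, scattering_angle p q \<omega>) \<in> N then 1 else 0) \<partial>sphere_borel"] by simp
  also have "\<dots> = (\<integral>\<^sup>+P. (\<integral>\<^sup>+u. 0 \<partial>(lborel :: (real^3) measure)) \<partial>(lborel :: (real^3) measure))"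
  proof (rule nn_integral_cong, rule nn_integral_cong_AE)
    fix P
    show "AE u in lborel. ennreal (cm_jacobian P u) * (\<integral>\<^sup>+\<omega>. ennreal (1 / (energy (cm_p P u) * energy (cm_q P u))) *
        (if (rel_momentum (cm_p P u) (cm_q P u), scattering_angle (cm_p P u) (cm_q P u) \<omega>) \<in> N then 1 else 0) \<partial>sphere_borel) = 0"
      using *[of P] by eventually_elim simp
  qed
  finally show "AE x in (lborel :: real measure). (\<integral>\<^sup>+p. (\<integral>\<^sup>+q. (\<integral>\<^sup>+\<omega>. ennreal (1 / (energy p * energy q)) *
        (if (rel_momentum p q, scattering_angle p q \<omega>) \<in> N then 1 else 0) \<partial>sphere_borel) \<partial>lborel) \<partial>lborel) = 0"
    by simp
qed

section \<open>Borel representatives and essential suprema\<close>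

lemma lebesgue_on_borel_representative:
  fixes f :: "'a::euclidean_space \<Rightarrow> real"
  assumes S: "S \<in> sets lebesgue" and f: "f \<in> borel_measurable (lebesgue_on S)"
  obtains g N where "g \<in> borel_measurable borel" "N \<in> null_sets lborel" "\<And>z. z \<in> S \<Longrightarrow> z \<notin> N \<Longrightarrow> f z = g z"
proof -
  \<comment> \<open>Extended by zero off \<open>S\<close>, f is measurable for the completed measure
    on the whole space and so has a Borel version.\<close>
  have "(\<lambda>x. indicator S x *\<^sub>R f x) \<in> borel_measurable (completion lborel)"
    using f S by (subst (asm) borel_measurable_restrict_space_iff) simp_all
  then obtain g where g: "g \<in> borel_measurable lborel" "AE x in lborel. indicator S x *\<^sub>R f x = g x"
    using completion_ex_borel_measurable_real by blast
  obtain N where N: "\<And>x. x \<in> space lborel - N \<Longrightarrow> indicator S x *\<^sub>R f x = g x" "N \<in> null_sets lborel"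
    using AE_E3[OF g(2)] by blast
  show ?thesis
  proof (rule that)
    show "g \<in> borel_measurable borel" using g by simp
    show "N \<in> null_sets lborel" by fact
    show "f z = g z" if "z \<in> S" "z \<notin> N" for z using N(1)[of z] that by simp
  qed
qed

text \<open>Lebesgue measure is complete, so measurability passes to any function that agrees with v
  almost everywhere on \<open>S\<close>.\<close>

lemma borel_measurable_lebesgue_on_AE:
  fixes v :: "'a::euclidean_space \<Rightarrow> 'b::topological_space"
  assumes v: "v \<in> borel_measurable borel" and S: "S \<in> sets borel"
    and eq: "AE x in lborel. x \<in> S \<longrightarrow> u x = v x"
  shows "u \<in> borel_measurable (lebesgue_on S)"
proof (rule measurableI)
  fix A :: "'b set" assume A: "A \<in> sets borel"
  have a: "v -` A \<inter> S \<in> sets lebesgue"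
    using measurable_sets_borel[OF v A] S by auto
  have b: "AE x in lebesgue. x \<in> v -` A \<inter> S \<longleftrightarrow> x \<in> u -` A \<inter> S"
    unfolding AE_completion_iff using eq by eventually_elim auto
  have "u -` A \<inter> S \<in> sets lebesgue"
    by (rule completion.in_sets_AE[OF b a]) simp
  then show "u -` A \<inter> space (lebesgue_on S) \<in> sets (lebesgue_on S)"
    using S by (simp add: sets_restrict_space_iff)
qed simp

text \<open>\<open>esssup\<close> takes the value top on non-measurable functions, so measurability
  is what lets an almost-everywhere bound control \<open>Linf\<close>.\<close>

lemma Linf_le_iff:
  assumes "u \<in> borel_measurable (lebesgue_on {0..1})"
  shows "Linf u \<le> c \<longleftrightarrow> (AE x in lborel. x \<in> {0..1} \<longrightarrow> u x \<le> c)"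
proof -
  have "(AE x in lebesgue_on {0..1}. u x \<le> c) \<longleftrightarrow> (AE x in lborel. x \<in> {0..1} \<longrightarrow> u x \<le> c)" for c
    by (subst AE_restrict_space_iff) (simp_all add: AE_completion_iff)
  moreover have "Linf u \<le> c \<longleftrightarrow> (AE x in lebesgue_on {0..1}. u x \<le> c)"
    unfolding Linf_def
  proof
    assume le: "esssup (lebesgue_on {0..1}) u \<le> c"
    show "AE x in lebesgue_on {0..1}. u x \<le> c"
      using esssup_AE[of u "lebesgue_on {0..1}"] by eventually_elim (rule order_trans[OF _ le])
  qed (rule esssup_I[OF assms])
  ultimately show ?thesis by simp
qed

text \<open>A sublevel set consists of those p at which a parameter integral vanishes, namely the
  measure of the x in [0, 1] with F (x, p) > y.\<close>

lemma borel_measurable_Linf: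
  assumes F[measurable]: "F \<in> borel_measurable (borel \<Otimes>\<^sub>M borel)"
  shows "(\<lambda>p. Linf (\<lambda>x. F (x, p))) \<in> borel_measurable borel"
proof (rule borel_measurableI_le)
  fix y
  have "Linf (\<lambda>x. F (x, p)) \<le> y \<longleftrightarrow> (\<integral>\<^sup>+x. (if x \<in> {0..1} \<and> \<not> F (x, p) \<le> y then 1 else 0) \<partial>lborel) = 0" for p
  proof -
    have [measurable]: "(\<lambda>x. F (x, p)) \<in> borel_measurable borel" by measurable
    have "(\<lambda>x. F (x, p)) \<in> borel_measurable (lebesgue_on {0..1})"
      by (rule borel_measurable_lebesgue_on_AE[of "\<lambda>x. F (x, p)"]) simp_all
    moreover have "(\<integral>\<^sup>+x. (if x \<in> {0..1} \<and> \<not> F (x, p) \<le> y then 1 else 0) \<partial>lborel) = 0 \<longleftrightarrow>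
       (AE x in lborel. (if x \<in> {0..1} \<and> \<not> F (x, p) \<le> y then 1 else 0 :: ennreal) = 0)"
      by (rule nn_integral_0_iff_AE) measurable
    moreover have "(if x \<in> {0..1} \<and> \<not> F (x, p) \<le> y then 1 else 0 :: ennreal) = 0 \<longleftrightarrow> (x \<in> {0..1} \<longrightarrow> F (x, p) \<le> y)" for x
      by simp
    ultimately show ?thesis by (simp only: Linf_le_iff)
  qed
  then show "{p \<in> space borel. Linf (\<lambda>x. F (x, p)) \<le> y} \<in> sets borel"
    by simp
qed

text \<open>The bound holds for each p and almost every x. As \<open>Linf\<close> is measurable in
  p, the set of good pairs is measurable, and Fubini gives almost every pair.\<close>

lemma AE_le_Linf:
  fixes F :: "real \<times> (real^3) \<Rightarrow> ennreal"
  assumes F[measurable]: "F \<in> borel_measurable borel"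
  shows "AE z in lborel. fst z \<in> {0..1} \<longrightarrow> F z \<le> Linf (\<lambda>x. F (x, snd z))"
proof -
  have F'[measurable]: "F \<in> borel_measurable (borel \<Otimes>\<^sub>M borel)" using F by (simp add: borel_prod)
  note borel_measurable_Linf[OF F', measurable]
  have m: "{z \<in> space (lborel \<Otimes>\<^sub>M lborel). fst z \<in> {0..1} \<longrightarrow> F z \<le> Linf (\<lambda>x. F (x, snd z))}
      \<in> sets (lborel \<Otimes>\<^sub>M (lborel :: (real^3) measure))"
    by measurable
  have "AE p in lborel. AE x in lborel. x \<in> {0..1} \<longrightarrow> F (x, p) \<le> Linf (\<lambda>x. F (x, p))"
  proof (rule always_eventually, rule allI)
    fix p
    have [measurable]: "(\<lambda>x. F (x, p)) \<in> borel_measurable borel" by measurable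
    have "(\<lambda>x. F (x, p)) \<in> borel_measurable (lebesgue_on {0..1})"
      by (rule borel_measurable_lebesgue_on_AE[of "\<lambda>x. F (x, p)"]) simp_all
    then show "AE x in lborel. x \<in> {0..1} \<longrightarrow> F (x, p) \<le> Linf (\<lambda>x. F (x, p))"
      by (subst Linf_le_iff[symmetric]) simp_all
  qed
  then have "AE x in lborel. AE p in lborel. x \<in> {0..1} \<longrightarrow> F (x, p) \<le> Linf (\<lambda>x. F (x, p))"
    by (subst lborel_pair.AE_commute) measurable
  then show ?thesis
    unfolding lborel_prod[symmetric] by (intro lborel_pair.AE_pair_measure[OF m]) (simp only: fst_conv snd_conv)
qed

lemma AE_lborel_swap_notin:
  assumes N: "N \<in> null_sets (lborel :: (real \<times> (real^3)) measure)"
  shows "AE p in lborel. AE x in lborel. (x, p) \<notin> N"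
proof -
  have [measurable]: "N \<in> sets borel" using N by auto
  have "AE z in lborel \<Otimes>\<^sub>M lborel. z \<notin> N" unfolding lborel_prod by (rule AE_not_in[OF N])
  then have "AE x in lborel. AE p in lborel. (x, p) \<notin> N"
    by (rule lborel_pair.AE_pair)
  then show ?thesis by (subst (asm) lborel_pair.AE_commute) measurable
qed

text \<open>\<open>F\<close> serves the measurability of the integrand, \<open>L\<close> is an
  envelope independent of x, and a single null set \<open>N\<close> covers both, ready to be pulled
  back by the collision map.\<close>

lemma Linf_representative:
  fixes f :: "real \<Rightarrow> real^3 \<Rightarrow> real"
  assumes f: "(\<lambda>(x, p). f x p) \<in> borel_measurable (lebesgue_on ({0..1} \<times> UNIV))"
    and nonneg: "\<And>x p. x \<in> {0..1} \<Longrightarrow> 0 \<le> f x p"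
  obtains F :: "real \<times> (real^3) \<Rightarrow> real" and L N
  where "F \<in> borel_measurable borel" "L \<in> borel_measurable borel" "N \<in> null_sets lborel"
    "\<And>x p. x \<in> {0..1} \<Longrightarrow> (x, p) \<notin> N \<Longrightarrow> f x p = F (x, p) \<and> ennreal (f x p) \<le> L p"
    "AE p in lborel. Linf (\<lambda>x. ennreal \<bar>f x p\<bar>) = L p"
proof -
  have S: "{0..1} \<times> UNIV \<in> sets (lebesgue :: (real \<times> (real^3)) measure)"
    by (intro sets_completionI_sets) (simp add: closed_Times)
  obtain F N1 where F: "F \<in> borel_measurable borel" and N1: "N1 \<in> null_sets lborel"
    and eq: "\<And>z. z \<in> {0..1} \<times> UNIV \<Longrightarrow> z \<notin> N1 \<Longrightarrow> (\<lambda>(x, p). f x p) z = F z"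
    using lebesgue_on_borel_representative[OF S f] by blast
  have F'[measurable]: "F \<in> borel_measurable (borel \<Otimes>\<^sub>M borel)" using F by (simp add: borel_prod)
  \<comment> \<open>\<open>ennreal\<close> sends negative values to 0; for x in [0, 1] these occur
    only on a null set, because f is non-negative there.\<close>
  define L where "L p = Linf (\<lambda>x. ennreal (F (x, p)))" for p
  have F_ennreal: "(\<lambda>z. ennreal (F z)) \<in> borel_measurable borel" using F by simp
  obtain N2 where le: "\<And>z. z \<in> space lborel - N2 \<Longrightarrow> fst z \<in> {0..1} \<longrightarrow> ennreal (F z) \<le> L (snd z)"
    and N2: "N2 \<in> null_sets lborel"
    using AE_E3[OF AE_le_Linf[OF F_ennreal]] unfolding L_def by blast
  show ?thesis
  proof (rule that)
    show "F \<in> borel_measurable borel" by fact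
    show "L \<in> borel_measurable borel"
      unfolding L_def[abs_def] using borel_measurable_Linf[of "\<lambda>z. ennreal (F z)"] by simp
    show "N1 \<union> N2 \<in> null_sets lborel" using N1 N2 by auto
    show "f x p = F (x, p) \<and> ennreal (f x p) \<le> L p" if "x \<in> {0..1}" "(x, p) \<notin> N1 \<union> N2" for x p
      using that eq[of "(x, p)"] le[of "(x, p)"] by auto
    show "AE p in lborel. Linf (\<lambda>x. ennreal \<bar>f x p\<bar>) = L p"
      using AE_lborel_swap_notin[OF N1]
    proof eventually_elim
      case (elim p)
      then have ae: "AE x in lborel. x \<in> {0..1} \<longrightarrow> ennreal \<bar>f x p\<bar> = ennreal (F (x, p))"
      proof eventually_elim
        case (elim x)
        then show ?case using eq[of "(x, p)"] nonneg[of x p] by auto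
      qed
      have m: "(\<lambda>x. ennreal (F (x, p))) \<in> borel_measurable borel" by measurable
      have "(\<lambda>x. ennreal \<bar>f x p\<bar>) \<in> borel_measurable (lebesgue_on {0..1})"
        by (rule borel_measurable_lebesgue_on_AE[OF m _ ae]) simp
      moreover have "(\<lambda>x. ennreal (F (x, p))) \<in> borel_measurable (lebesgue_on {0..1})"
        by (rule borel_measurable_lebesgue_on_AE[OF m]) simp_all
      moreover have "AE x in lebesgue_on {0..1}. ennreal \<bar>f x p\<bar> = ennreal (F (x, p))"
        using ae by (subst AE_restrict_space_iff) (simp_all add: AE_completion_iff)
      ultimately show ?case
        unfolding L_def Linf_def by (rule esssup_AE_cong)
    qed
  qed
qed

section \<open>Essential supremum of the gain term\<close>

lemma scattering_angle_range:
  assumes "norm \<omega> = 1"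
  shows "scattering_angle p q \<omega> \<in> {0..pi}"
proof -
  obtain P u where cm: "cm_p P u = p" "cm_q P u = q" by (metis collision_cases)
  have "\<bar>u \<bullet> \<omega>\<bar> \<le> norm u" using Cauchy_Schwarz_ineq2[of u \<omega>] assms by simp
  \<comment> \<open>For u = 0, that is p = q, the quotient is 0 by convention and still in
    range.\<close>
  then have "\<bar>(u \<bullet> \<omega>) / norm u\<bar> \<le> 1" by (cases "u = 0") simp_all
  then have "\<bar>cos_scattering p q \<omega>\<bar> \<le> 1"
    using cos_scattering_cm[OF assms, of P u, unfolded cm] by (simp only:)
  then show ?thesis by (simp add: scattering_angle_def abs_le_iff arccos_lbound arccos_ubound)
qed

lemma rel_momentum_nonneg: "0 \<le> rel_momentum p q"
proof -
  obtain P u where cm: "cm_p P u = p" "cm_q P u = q" by (metis collision_cases)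
  show ?thesis using rel_momentum_cm[of P u, unfolded cm] by simp
qed

lemma mandelstam_s_pos: "0 < mandelstam_s p q"
  by (simp add: mandelstam_s_def add_nonneg_pos)

lemma moller_velocity_nonneg: "0 \<le> moller_velocity p q"
  using rel_momentum_nonneg[of p q] mandelstam_s_pos[of p q] energy_pos[of p] energy_pos[of q]
  by (simp add: moller_velocity_def)

text \<open>Outside the pulled-back null sets the integrand equals a Borel function of all variables
  and lies below an envelope independent of x. The equality makes the gain measurable in x, the
  inequality bounds it.\<close>

lemma AE_Linf_gain_le:
  fixes f h :: "real \<Rightarrow> real^3 \<Rightarrow> real"
  assumes \<sigma>: "(\<lambda>(g, \<theta>). \<sigma> g \<theta>) \<in> borel_measurable (lebesgue_on ({0..} \<times> {0..pi}))"
    and \<sigma>_le: "\<And>g \<theta>. 0 \<le> g \<Longrightarrow> \<theta> \<in> {0..pi} \<Longrightarrow> 0 \<le> \<sigma> g \<theta> \<and> \<sigma> g \<theta> \<le> c * g"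
    and nonneg: "\<And>x p. x \<in> {0..1} \<Longrightarrow> 0 \<le> f x p" "\<And>x p. x \<in> {0..1} \<Longrightarrow> 0 \<le> h x p"
    and F[measurable]: "F \<in> borel_measurable borel" and Lf[measurable]: "Lf \<in> borel_measurable borel"
    and Nf: "Nf \<in> null_sets lborel"
    and f: "\<And>x p. x \<in> {0..1} \<Longrightarrow> (x, p) \<notin> Nf \<Longrightarrow> f x p = F (x, p) \<and> ennreal (f x p) \<le> Lf p"
    and H[measurable]: "H \<in> borel_measurable borel" and Lh[measurable]: "Lh \<in> borel_measurable borel"
    and Nh: "Nh \<in> null_sets lborel"
    and h: "\<And>x p. x \<in> {0..1} \<Longrightarrow> (x, p) \<notin> Nh \<Longrightarrow> h x p = H (x, p) \<and> ennreal (h x p) \<le> Lh p"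
  shows "AE p in lborel. Linf (\<lambda>x. gain \<sigma> f h x p) \<le>
    (\<integral>\<^sup>+q. (\<integral>\<^sup>+\<omega>. ennreal (moller_velocity p q * (c * rel_momentum p q)) *
       (Lf (post_p p q \<omega>) * Lh (post_q p q \<omega>)) \<partial>sphere_borel) \<partial>lborel)"
proof -
  have "{0..} \<times> {0..pi} \<in> sets (lebesgue :: (real \<times> real) measure)"
    by (intro sets_completionI_sets) (simp add: closed_Times)
  then obtain G N where G[measurable]: "G \<in> borel_measurable borel" and N: "N \<in> null_sets lborel"
    and G_eq: "\<And>z. z \<in> {0..} \<times> {0..pi} \<Longrightarrow> z \<notin> N \<Longrightarrow> (\<lambda>(g, \<theta>). \<sigma> g \<theta>) z = G z"
    using lebesgue_on_borel_representative[OF _ \<sigma>] by blast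
  let ?I = "\<lambda>x p q \<omega>. ennreal (moller_velocity p q * \<sigma> (rel_momentum p q) (scattering_angle p q \<omega>)
                * f x (post_p p q \<omega>) * h x (post_q p q \<omega>))"
  let ?J = "\<lambda>x p q \<omega>. ennreal (moller_velocity p q * G (rel_momentum p q, scattering_angle p q \<omega>)
                * F (x, post_p p q \<omega>) * H (x, post_q p q \<omega>))"
  let ?K = "\<lambda>p q \<omega>. ennreal (moller_velocity p q * (c * rel_momentum p q)) *
       (Lf (post_p p q \<omega>) * Lh (post_q p q \<omega>))"
  have ptw: "?I x p q \<omega> = ?J x p q \<omega>" "?I x p q \<omega> \<le> ?K p q \<omega>"
    if "x \<in> {0..1}" "norm \<omega> = 1" "(x, post_p p q \<omega>) \<notin> Nf" "(x, post_q p q \<omega>) \<notin> Nh"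
      "(rel_momentum p q, scattering_angle p q \<omega>) \<notin> N" for x p q \<omega>
  proof -
    note ang = scattering_angle_range[OF that(2), of p q] and g = rel_momentum_nonneg[of p q]
    have eq: "\<sigma> (rel_momentum p q) (scattering_angle p q \<omega>) = G (rel_momentum p q, scattering_angle p q \<omega>)"
      using G_eq[of "(rel_momentum p q, scattering_angle p q \<omega>)"] that(5) ang g by simp
    show "?I x p q \<omega> = ?J x p q \<omega>"
      using f[OF that(1,3)] h[OF that(1,4)] by (simp add: eq)
    have s: "0 \<le> \<sigma> (rel_momentum p q) (scattering_angle p q \<omega>)"
      "\<sigma> (rel_momentum p q) (scattering_angle p q \<omega>) \<le> c * rel_momentum p q"
      using \<sigma>_le[OF g ang] by simp_all
    have "?I x p q \<omega> = ennreal (moller_velocity p q * \<sigma> (rel_momentum p q) (scattering_angle p q \<omega>))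
                * (ennreal (f x (post_p p q \<omega>)) * ennreal (h x (post_q p q \<omega>)))"
      using s(1) moller_velocity_nonneg[of p q] nonneg[OF that(1)] by (simp add: ennreal_mult mult.assoc)
    also have "\<dots> \<le> ?K p q \<omega>"
      using s(2) moller_velocity_nonneg[of p q] f[OF that(1,3)] h[OF that(1,4)]
      by (intro mult_mono ennreal_leI mult_left_mono) auto
    finally show "?I x p q \<omega> \<le> ?K p q \<omega>" .
  qed
  show ?thesis
    using AE_post_notin_null_set(1)[OF Nf] AE_post_notin_null_set(2)[OF Nh] AE_scattering_notin_null_set[OF N]
  proof eventually_elim
    case (elim p)
    have gain: "gain \<sigma> f h x p = (\<integral>\<^sup>+q. (\<integral>\<^sup>+\<omega>. ?I x p q \<omega> \<partial>sphere_measure) \<partial>lborel)" for x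
      unfolding gain_def by (rule nn_integral_completion)
    have "AE x in lborel. x \<in> {0..1} \<longrightarrow>
        gain \<sigma> f h x p = (\<integral>\<^sup>+q. (\<integral>\<^sup>+\<omega>. ?J x p q \<omega> \<partial>sphere_borel) \<partial>lborel) \<and>
        gain \<sigma> f h x p \<le> (\<integral>\<^sup>+q. (\<integral>\<^sup>+\<omega>. ?K p q \<omega> \<partial>sphere_borel) \<partial>lborel)"
      using elim
    proof eventually_elim
      case (elim x)
      show ?case
      proof
        assume x: "x \<in> {0..1}"
        have "AE q in lborel. (\<integral>\<^sup>+\<omega>. ?I x p q \<omega> \<partial>sphere_measure) = (\<integral>\<^sup>+\<omega>. ?J x p q \<omega> \<partial>sphere_borel) \<and>
            (\<integral>\<^sup>+\<omega>. ?I x p q \<omega> \<partial>sphere_measure) \<le> (\<integral>\<^sup>+\<omega>. ?K p q \<omega> \<partial>sphere_borel)"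
          using elim
        proof eventually_elim
          case (elim q)
          have I_eq: "AE \<omega> in sphere_borel. ?I x p q \<omega> = ?J x p q \<omega>"
            using elim AE_sphere_borel_norm by eventually_elim (intro ptw(1) x; assumption)
          have I_le: "AE \<omega> in sphere_borel. ?I x p q \<omega> \<le> ?K p q \<omega>"
            using elim AE_sphere_borel_norm by eventually_elim (intro ptw(2) x; assumption)
          have "(\<integral>\<^sup>+\<omega>. ?I x p q \<omega> \<partial>sphere_measure) = (\<integral>\<^sup>+\<omega>. ?J x p q \<omega> \<partial>sphere_measure)"
            by (rule nn_integral_cong_AE) (rule AE_sphere_measure[OF I_eq])
          moreover have "(\<integral>\<^sup>+\<omega>. ?J x p q \<omega> \<partial>sphere_measure) = (\<integral>\<^sup>+\<omega>. ?J x p q \<omega> \<partial>sphere_borel)"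
            by (rule nn_integral_sphere_measure) measurable
          moreover have "(\<integral>\<^sup>+\<omega>. ?I x p q \<omega> \<partial>sphere_measure) \<le> (\<integral>\<^sup>+\<omega>. ?K p q \<omega> \<partial>sphere_measure)"
            by (rule nn_integral_mono_AE) (rule AE_sphere_measure[OF I_le])
          moreover have "(\<integral>\<^sup>+\<omega>. ?K p q \<omega> \<partial>sphere_measure) = (\<integral>\<^sup>+\<omega>. ?K p q \<omega> \<partial>sphere_borel)"
            by (rule nn_integral_sphere_measure) measurable
          ultimately show ?case by (simp only:)
        qed
        then show "gain \<sigma> f h x p = (\<integral>\<^sup>+q. (\<integral>\<^sup>+\<omega>. ?J x p q \<omega> \<partial>sphere_borel) \<partial>lborel) \<and>
            gain \<sigma> f h x p \<le> (\<integral>\<^sup>+q. (\<integral>\<^sup>+\<omega>. ?K p q \<omega> \<partial>sphere_borel) \<partial>lborel)"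
          unfolding gain AE_conj_iff by (auto intro: nn_integral_cong_AE nn_integral_mono_AE)
      qed
    qed
    note both = this
    have eq: "AE x in lborel. x \<in> {0..1} \<longrightarrow> gain \<sigma> f h x p = (\<integral>\<^sup>+q. (\<integral>\<^sup>+\<omega>. ?J x p q \<omega> \<partial>sphere_borel) \<partial>lborel)"
      using both by eventually_elim blast
    have le: "AE x in lborel. x \<in> {0..1} \<longrightarrow> gain \<sigma> f h x p \<le> (\<integral>\<^sup>+q. (\<integral>\<^sup>+\<omega>. ?K p q \<omega> \<partial>sphere_borel) \<partial>lborel)"
      using both by eventually_elim blast
    \<comment> \<open>Without measurability in x the essential supremum would be infinite by
      definition.\<close>
    have "(\<lambda>x. gain \<sigma> f h x p) \<in> borel_measurable (lebesgue_on {0..1})"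
      by (rule borel_measurable_lebesgue_on_AE[OF _ _ eq]) measurable
    then show ?case using le by (subst Linf_le_iff)
  qed
qed

section \<open>The weighted estimate\<close>

text \<open>The bound \<open>A\<close> is uniform in a, so it leaves the q-integral although the
  singularity a = -q moves with q.\<close>

lemma nn_integral_gain_le:
  assumes k: "k > 0" and c: "c \<ge> 0"
    and Lf[measurable]: "Lf \<in> borel_measurable borel" and Lh[measurable]: "Lh \<in> borel_measurable borel"
    and A: "\<And>a. (\<integral>\<^sup>+p. ennreal (sqrt (energy p) * exp_weight k p / norm (p - a)) * Lf p \<partial>lborel) \<le> A"
  shows "(\<integral>\<^sup>+p. ennreal (exp_weight k p) *
      (\<integral>\<^sup>+q. (\<integral>\<^sup>+\<omega>. ennreal (moller_velocity p q * (c / (4 * pi) * rel_momentum p q)) *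
       (Lf (post_p p q \<omega>) * Lh (post_q p q \<omega>)) \<partial>sphere_borel) \<partial>lborel) \<partial>lborel)
    \<le> ennreal (48 * c / k) * A * (\<integral>\<^sup>+q. ennreal (sqrt (energy q) * exp_weight k q) * Lh q \<partial>lborel)"
proof -
  have [measurable]: "exp_weight k \<in> borel_measurable borel"
    unfolding exp_weight_def[abs_def] by measurable
  have ew: "0 \<le> exp_weight k p" for p by (simp add: exp_weight_def)
  let ?w = "\<lambda>p q. c / (4 * pi) * (rel_momentum p q)\<^sup>2 * sqrt (mandelstam_s p q)"
  have w: "0 \<le> ?w p q" for p q using c mandelstam_s_pos[of p q] by simp
  have w': "0 \<le> ?w p q / (energy p * energy q)" for p q
    by (intro divide_nonneg_pos w mult_pos_pos energy_pos)
  \<comment> \<open>The weight sits on the first pair and the profiles \<open>Lf\<close>,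
    \<open>Lh\<close> on the second, as \<open>collision_symmetry\<close> will exchange
    them.\<close>
  let ?f = "\<lambda>z. ennreal (exp_weight k (fst (fst z)) * ?w (fst (fst z)) (snd (fst z))) * (Lf (fst (snd z)) * Lh (snd (snd z)))"
  have "(\<integral>\<^sup>+p. ennreal (exp_weight k p) *
      (\<integral>\<^sup>+q. (\<integral>\<^sup>+\<omega>. ennreal (moller_velocity p q * (c / (4 * pi) * rel_momentum p q)) *
       (Lf (post_p p q \<omega>) * Lh (post_q p q \<omega>)) \<partial>sphere_borel) \<partial>lborel) \<partial>lborel)
    = (\<integral>\<^sup>+p. (\<integral>\<^sup>+q. (\<integral>\<^sup>+\<omega>. ennreal (exp_weight k p) * (ennreal (moller_velocity p q * (c / (4 * pi) * rel_momentum p q)) *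
       (Lf (post_p p q \<omega>) * Lh (post_q p q \<omega>))) \<partial>sphere_borel) \<partial>lborel) \<partial>lborel)"
  proof (rule nn_integral_cong)
    fix p
    show "ennreal (exp_weight k p) *
      (\<integral>\<^sup>+q. (\<integral>\<^sup>+\<omega>. ennreal (moller_velocity p q * (c / (4 * pi) * rel_momentum p q)) *
       (Lf (post_p p q \<omega>) * Lh (post_q p q \<omega>)) \<partial>sphere_borel) \<partial>lborel)
      = (\<integral>\<^sup>+q. (\<integral>\<^sup>+\<omega>. ennreal (exp_weight k p) * (ennreal (moller_velocity p q * (c / (4 * pi) * rel_momentum p q)) *
       (Lf (post_p p q \<omega>) * Lh (post_q p q \<omega>))) \<partial>sphere_borel) \<partial>lborel)"
      by (subst nn_integral_cmult[symmetric], measurable, intro nn_integral_cong nn_integral_cmult[symmetric]) measurable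
  qed
  also have "\<dots> = (\<integral>\<^sup>+p. (\<integral>\<^sup>+q. (\<integral>\<^sup>+\<omega>. ennreal (1 / (energy p * energy q)) *
        ?f ((p, q), (post_p p q \<omega>, post_q p q \<omega>)) \<partial>sphere_borel) \<partial>lborel) \<partial>lborel)"
  proof (intro nn_integral_cong)
    fix p q \<omega>
    have "exp_weight k p * (moller_velocity p q * (c / (4 * pi) * rel_momentum p q)) =
       1 / (energy p * energy q) * (exp_weight k p * ?w p q)"
      by (simp add: moller_velocity_def power2_eq_square)
    then have "ennreal (exp_weight k p) * ennreal (moller_velocity p q * (c / (4 * pi) * rel_momentum p q))
      = ennreal (1 / (energy p * energy q)) * ennreal (exp_weight k p * ?w p q)"
      using ew[of p] mult_nonneg_nonneg[OF ew[of p] w[of p q]] energy_pos[of p] energy_pos[of q] moller_velocity_nonneg[of p q] rel_momentum_nonneg[of p q] c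
      by (subst (1 2) ennreal_mult[symmetric]) simp_all
    then show "ennreal (exp_weight k p) * (ennreal (moller_velocity p q * (c / (4 * pi) * rel_momentum p q)) *
         (Lf (post_p p q \<omega>) * Lh (post_q p q \<omega>)))
      = ennreal (1 / (energy p * energy q)) * ?f ((p, q), (post_p p q \<omega>, post_q p q \<omega>))"
      by (simp only: fst_conv snd_conv mult.assoc[symmetric])
  qed
  also have "\<dots> = (\<integral>\<^sup>+p. (\<integral>\<^sup>+q. (\<integral>\<^sup>+\<omega>. ennreal (1 / (energy p * energy q)) *
        ?f ((post_p p q \<omega>, post_q p q \<omega>), (p, q)) \<partial>sphere_borel) \<partial>lborel) \<partial>lborel)"
    by (rule collision_symmetry) measurable
  also have "\<dots> = (\<integral>\<^sup>+p. (\<integral>\<^sup>+q. ennreal (?w p q / (energy p * energy q)) *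
        (\<integral>\<^sup>+\<omega>. ennreal (exp_weight k (post_p p q \<omega>)) \<partial>sphere_borel) * (Lf p * Lh q) \<partial>lborel) \<partial>lborel)"
  proof (intro nn_integral_cong)
    fix p q
    have "(\<integral>\<^sup>+\<omega>. ennreal (1 / (energy p * energy q)) *
        ?f ((post_p p q \<omega>, post_q p q \<omega>), (p, q)) \<partial>sphere_borel)
      = (\<integral>\<^sup>+\<omega>. (ennreal (?w p q / (energy p * energy q)) * (Lf p * Lh q)) * ennreal (exp_weight k (post_p p q \<omega>)) \<partial>sphere_borel)"
    proof (rule nn_integral_cong_AE, use AE_sphere_borel_norm in eventually_elim)
      fix \<omega> :: "real^3" assume "norm \<omega> = 1"
      \<comment> \<open>g and s are collision invariants, so only the exponential still depends on
        \<omega>.\<close>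
      then have w_post: "?w (post_p p q \<omega>) (post_q p q \<omega>) = ?w p q"
        by (simp add: rel_momentum_post mandelstam_s_def)
      have "ennreal (1 / (energy p * energy q)) * ennreal (exp_weight k (post_p p q \<omega>) * ?w p q)
        = ennreal (?w p q / (energy p * energy q)) * ennreal (exp_weight k (post_p p q \<omega>))"
        using ew[of "post_p p q \<omega>"] w[of p q] w'[of p q] mult_nonneg_nonneg[OF ew[of "post_p p q \<omega>"] w[of p q]] energy_pos[of p] energy_pos[of q]
        by (subst (1 2) ennreal_mult[symmetric]) (simp_all add: mult.commute)
      then show "ennreal (1 / (energy p * energy q)) * ?f ((post_p p q \<omega>, post_q p q \<omega>), (p, q))
        = (ennreal (?w p q / (energy p * energy q)) * (Lf p * Lh q)) * ennreal (exp_weight k (post_p p q \<omega>))"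
        unfolding fst_conv snd_conv w_post by (simp only: mult.assoc[symmetric]) (simp only: mult_ac)
    qed
    also have "\<dots> = (ennreal (?w p q / (energy p * energy q)) * (Lf p * Lh q)) *
        (\<integral>\<^sup>+\<omega>. ennreal (exp_weight k (post_p p q \<omega>)) \<partial>sphere_borel)"
      by (rule nn_integral_cmult) measurable
    finally show "(\<integral>\<^sup>+\<omega>. ennreal (1 / (energy p * energy q)) *
        ?f ((post_p p q \<omega>, post_q p q \<omega>), (p, q)) \<partial>sphere_borel)
      = ennreal (?w p q / (energy p * energy q)) *
        (\<integral>\<^sup>+\<omega>. ennreal (exp_weight k (post_p p q \<omega>)) \<partial>sphere_borel) * (Lf p * Lh q)"
      by (simp only: mult_ac)
  qed
  \<comment> \<open>Integrating over p first, at fixed q, meets the singular integral with a =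
    -q.\<close>
  also have "\<dots> = (\<integral>\<^sup>+q. (\<integral>\<^sup>+p. ennreal (?w p q / (energy p * energy q)) *
        (\<integral>\<^sup>+\<omega>. ennreal (exp_weight k (post_p p q \<omega>)) \<partial>sphere_borel) * (Lf p * Lh q) \<partial>lborel) \<partial>lborel)"
    by (rule lborel_pair.Fubini'[symmetric]) measurable
  also have "\<dots> \<le> (\<integral>\<^sup>+q. ennreal (48 * c / k) * A * (ennreal (sqrt (energy q) * exp_weight k q) * Lh q) \<partial>lborel)"
  proof (rule nn_integral_mono)
    fix q :: "real^3"
    let ?B = "ennreal (48 * c / k) * (ennreal (sqrt (energy q) * exp_weight k q) * Lh q)"
    have "(\<integral>\<^sup>+p. ennreal (?w p q / (energy p * energy q)) *
        (\<integral>\<^sup>+\<omega>. ennreal (exp_weight k (post_p p q \<omega>)) \<partial>sphere_borel) * (Lf p * Lh q) \<partial>lborel)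
      \<le> (\<integral>\<^sup>+p. ?B * (ennreal (sqrt (energy p) * exp_weight k p / norm (p - (- q))) * Lf p) \<partial>lborel)"
    proof (rule nn_integral_mono_AE, use AE_lborel_singleton[of "- q"] in eventually_elim)
      fix p assume "p \<noteq> - q"
      then have "p + q \<noteq> 0" by (simp add: eq_neg_iff_add_eq_0)
      from gain_kernel_bound[OF k c this]
      have "ennreal (?w p q / (energy p * energy q)) * (\<integral>\<^sup>+\<omega>. ennreal (exp_weight k (post_p p q \<omega>)) \<partial>sphere_borel) * (Lf p * Lh q)
        \<le> ennreal (48 * c / k) * ennreal (sqrt (energy p) * exp_weight k p / norm (p + q))
        * ennreal (sqrt (energy q) * exp_weight k q) * (Lf p * Lh q)"
        by (rule mult_right_mono) simp
      then show "ennreal (?w p q / (energy p * energy q)) * (\<integral>\<^sup>+\<omega>. ennreal (exp_weight k (post_p p q \<omega>)) \<partial>sphere_borel) * (Lf p * Lh q)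
        \<le> ?B * (ennreal (sqrt (energy p) * exp_weight k p / norm (p - (- q))) * Lf p)"
        by (simp only: diff_minus_eq_add mult_ac)
    qed
    also have "\<dots> = ?B * (\<integral>\<^sup>+p. ennreal (sqrt (energy p) * exp_weight k p / norm (p - (- q))) * Lf p \<partial>lborel)"
      by (rule nn_integral_cmult) measurable
    also have "\<dots> \<le> ?B * A"
      by (rule mult_left_mono[OF A]) simp
    finally show "(\<integral>\<^sup>+p. ennreal (?w p q / (energy p * energy q)) *
        (\<integral>\<^sup>+\<omega>. ennreal (exp_weight k (post_p p q \<omega>)) \<partial>sphere_borel) * (Lf p * Lh q) \<partial>lborel)
      \<le> ennreal (48 * c / k) * A * (ennreal (sqrt (energy q) * exp_weight k q) * Lh q)"
      by (simp only: mult_ac)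
  qed
  also have "\<dots> = ennreal (48 * c / k) * A * (\<integral>\<^sup>+q. ennreal (sqrt (energy q) * exp_weight k q) * Lh q \<partial>lborel)"
    by (rule nn_integral_cmult) measurable
  finally show ?thesis .
qed

theorem lemma3p2:
  fixes \<sigma> :: "real \<Rightarrow> real \<Rightarrow> real" and \<sigma>\<^sub>0 :: "real \<Rightarrow> real"
  assumes "hard_sphere_kernel \<sigma> \<sigma>\<^sub>0"
  shows "\<exists>C>0. \<forall>k>0. \<forall>f h :: real \<Rightarrow> real^3 \<Rightarrow> real.
    (\<lambda>(x, p). f x p) \<in> borel_measurable (lebesgue_on ({0..1} \<times> UNIV)) \<longrightarrow>
    (\<lambda>(x, p). h x p) \<in> borel_measurable (lebesgue_on ({0..1} \<times> UNIV)) \<longrightarrow>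
    (\<forall>x\<in>{0..1}. \<forall>p. 0 \<le> f x p \<and> 0 \<le> h x p) \<longrightarrow>
    (\<integral>\<^sup>+ p. ennreal (exp_weight k p) * Linf (\<lambda>x. gain \<sigma> f h x p) \<partial>lebesgue)
      \<le> ennreal (C / k) * weighted_norm_m1 (exp_weight k) f * weighted_norm (exp_weight k) h"
proof -
  have \<sigma>: "(\<lambda>(g, \<theta>). \<sigma> g \<theta>) \<in> borel_measurable (lebesgue_on ({0..} \<times> {0..pi}))"
    and \<sigma>_nonneg: "\<And>g \<theta>. 0 \<le> g \<Longrightarrow> \<theta> \<in> {0..pi} \<Longrightarrow> 0 \<le> \<sigma> g \<theta>"
    and \<sigma>\<^sub>0: "\<And>\<theta>. \<theta> \<in> {0..pi} \<Longrightarrow> \<sigma>\<^sub>0 \<theta> \<le> 1 / (4 * pi)"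
    using assms by (auto simp: hard_sphere_kernel_def)
  obtain c where c: "c > 0" and \<sigma>_le: "\<And>g \<theta>. 0 \<le> g \<Longrightarrow> \<theta> \<in> {0..pi} \<Longrightarrow> \<sigma> g \<theta> \<le> c * (g * \<sigma>\<^sub>0 \<theta>)"
    using assms unfolding hard_sphere_kernel_def by blast
  \<comment> \<open>The bound 1 / (4 pi) on \<open>\<sigma>\<^sub>0\<close> removes the angle from
    the kernel.\<close>
  have \<sigma>_bounds: "0 \<le> \<sigma> g \<theta> \<and> \<sigma> g \<theta> \<le> c / (4 * pi) * g" if "0 \<le> g" "\<theta> \<in> {0..pi}" for g \<theta>
  proof -
    have "c * (g * \<sigma>\<^sub>0 \<theta>) \<le> c * (g * (1 / (4 * pi)))"
      using c that \<sigma>\<^sub>0[OF that(2)] by (intro mult_left_mono) auto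
    then show ?thesis
      using \<sigma>_nonneg[OF that] \<sigma>_le[OF that] by (auto simp: mult_ac)
  qed
  show ?thesis
  \<comment> \<open>c is the upper constant in the comparison of the kernel with
    \<open>g * \<sigma>\<^sub>0 \<theta>\<close>, chosen before k, f and h, so 48 c depends on the
    kernel alone.\<close>
  proof (intro exI[of _ "48 * c"] conjI allI impI)
    show "48 * c > 0" using c by simp
    fix k :: real and f h :: "real \<Rightarrow> real^3 \<Rightarrow> real"
    assume k: "k > 0"
      and f: "(\<lambda>(x, p). f x p) \<in> borel_measurable (lebesgue_on ({0..1} \<times> UNIV))"
      and h: "(\<lambda>(x, p). h x p) \<in> borel_measurable (lebesgue_on ({0..1} \<times> UNIV))"
      and nonneg: "\<forall>x\<in>{0..1}. \<forall>p. 0 \<le> f x p \<and> 0 \<le> h x p"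
    have f0: "0 \<le> f x p" and h0: "0 \<le> h x p" if "x \<in> {0..1}" for x p
      using nonneg that by blast+
    obtain F Lf Nf where F: "F \<in> borel_measurable borel" "Lf \<in> borel_measurable borel" "Nf \<in> null_sets lborel"
      "\<And>x p. x \<in> {0..1} \<Longrightarrow> (x, p) \<notin> Nf \<Longrightarrow> f x p = F (x, p) \<and> ennreal (f x p) \<le> Lf p"
      and Lf: "AE p in lborel. Linf (\<lambda>x. ennreal \<bar>f x p\<bar>) = Lf p"
      using Linf_representative[OF f f0] by blast
    obtain H Lh Nh where H: "H \<in> borel_measurable borel" "Lh \<in> borel_measurable borel" "Nh \<in> null_sets lborel"
      "\<And>x p. x \<in> {0..1} \<Longrightarrow> (x, p) \<notin> Nh \<Longrightarrow> h x p = H (x, p) \<and> ennreal (h x p) \<le> Lh p"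
      and Lh: "AE p in lborel. Linf (\<lambda>x. ennreal \<bar>h x p\<bar>) = Lh p"
      using Linf_representative[OF h h0] by blast
    have norm_f: "(\<integral>\<^sup>+p. ennreal (sqrt (energy p) * exp_weight k p / norm (p - a)) * Lf p \<partial>lborel)
        \<le> weighted_norm_m1 (exp_weight k) f" for a
    proof -
      have "(\<integral>\<^sup>+p. ennreal (sqrt (energy p) * exp_weight k p / norm (p - a)) * Lf p \<partial>lborel)
        = (\<integral>\<^sup>+p. ennreal (sqrt (energy p) * exp_weight k p / norm (p - a)) * Linf (\<lambda>x. ennreal \<bar>f x p\<bar>) \<partial>lebesgue)"
        unfolding nn_integral_completion by (rule nn_integral_cong_AE) (use Lf in eventually_elim, simp)
      also have "\<dots> \<le> weighted_norm_m1 (exp_weight k) f"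
        unfolding weighted_norm_m1_def by (rule SUP_upper) simp
      finally show ?thesis .
    qed
    have norm_h: "(\<integral>\<^sup>+q. ennreal (sqrt (energy q) * exp_weight k q) * Lh q \<partial>lborel) = weighted_norm (exp_weight k) h"
      unfolding weighted_norm_def nn_integral_completion
      by (rule nn_integral_cong_AE) (use Lh in eventually_elim, simp)
    have Linf_le: "AE p in lborel. Linf (\<lambda>x. gain \<sigma> f h x p) \<le>
      (\<integral>\<^sup>+q. (\<integral>\<^sup>+\<omega>. ennreal (moller_velocity p q * (c / (4 * pi) * rel_momentum p q)) *
       (Lf (post_p p q \<omega>) * Lh (post_q p q \<omega>)) \<partial>sphere_borel) \<partial>lborel)"
      by (rule AE_Linf_gain_le[OF \<sigma> \<sigma>_bounds f0 h0 F H])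
    have "(\<integral>\<^sup>+ p. ennreal (exp_weight k p) * Linf (\<lambda>x. gain \<sigma> f h x p) \<partial>lebesgue)
      \<le> (\<integral>\<^sup>+p. ennreal (exp_weight k p) *
      (\<integral>\<^sup>+q. (\<integral>\<^sup>+\<omega>. ennreal (moller_velocity p q * (c / (4 * pi) * rel_momentum p q)) *
       (Lf (post_p p q \<omega>) * Lh (post_q p q \<omega>)) \<partial>sphere_borel) \<partial>lborel) \<partial>lborel)"
      unfolding nn_integral_completion
    proof (rule nn_integral_mono_AE, use Linf_le in eventually_elim)
      case (elim p)
      then show ?case by (rule mult_left_mono) simp
    qed
    also have "\<dots> \<le> ennreal (48 * c / k) * weighted_norm_m1 (exp_weight k) f *
        (\<integral>\<^sup>+q. ennreal (sqrt (energy q) * exp_weight k q) * Lh q \<partial>lborel)"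
      using c by (intro nn_integral_gain_le k F H norm_f) simp
    finally show "(\<integral>\<^sup>+ p. ennreal (exp_weight k p) * Linf (\<lambda>x. gain \<sigma> f h x p) \<partial>lebesgue)
      \<le> ennreal (48 * c / k) * weighted_norm_m1 (exp_weight k) f * weighted_norm (exp_weight k) h"
      unfolding norm_h .
  qed
qed

end
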